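(* Let $q$ be a power of $2$ and let $m$ be even. Let $n=q^m-1$ and let $\beta$ be a primitive $n$-th root of unity in $\mathbb{F}_{q^m}$. Put $\delta=q^{\frac{m}{2}}-1$ and assume $\delta\ge 2$. Let $g(x)$ be the generator polynomial of the BCH code $\mathcal{C}_{(q,n,\delta,1,\beta)}$, let $h(x)=(x^n-1)/g(x)$, and let $g^\perp(x)=x^{\deg h(x)}h(x^{-1})/h(0)$ be the generator polynomial of $\mathcal{C}_{(q,n,\delta,1,\beta)}^\perp$. Let $\mathcal{C}'$ denote the cyclic code of length $2n$ over $\mathbb{F}_q$ with generator polynomial $g(x)g^\perp(x)$. Then $\mathcal{C}'$ is a Euclidean self-dual cyclic code with parameters $[2n,n,d]_q$, where $$d=\min\{2d(\mathcal{C}_{(q,n,\delta,1,\beta)}),\,d(\mathcal{C}_{(q,n,\delta,1,\beta)}^\perp)\}\ge q^{\frac{m}{2}}-1.$$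
   Context: An $[n,k,d]_q$ code is a $k$-dimensional linear subspace of $\mathbb{F}_q^n$ with minimum Hamming distance $d$; $d(\mathcal{C})$ denotes the minimum Hamming distance of $\mathcal{C}$. The Euclidean dual is $\mathcal{C}^\perp=\{c\in\mathbb{F}_q^n:\sum_i c_iy_i=0\ \forall y\in\mathcal{C}\}$; $\mathcal{C}$ is Euclidean self-dual if $\mathcal{C}=\mathcal{C}^\perp$. A cyclic code of length $N$ over $\mathbb{F}_q$ is identified with an ideal of $\mathbb{F}_q[x]/\langle x^N-1\rangle$ via $(c_0,\dots,c_{N-1})\mapsto c_0+c_1x+\dots+c_{N-1}x^{N-1}$; its generator polynomial is the unique monic divisor of $x^N-1$ generating it. For $\gcd(n,q)=1$ and $\beta$ a primitive $n$-th root of unity, $m_{\beta^i}(x)$ denotes the minimal polynomial of $\beta^i$ over $\mathbb{F}_q$. For integers $\delta\ge2$ and $b$, the BCH code $\mathcal{C}_{(q,n,\delta,b,\beta)}$ is the cyclic code of length $n$ over $\mathbb{F}_q$ with generator polynomial $\mathrm{lcm}\{m_{\beta^b}(x),\dots,m_{\beta^{b+\delta-2}}(x)\}$. *)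

theory Defs
  imports
    "Jordan_Normal_Form.VS_Connect"
    "HOL-Computational_Algebra.Polynomial_Factorial"
    "HOL-Library.Cardinality"
begin

section \<open>Linear codes\<close>

text \<open>A word of length \<open>N\<close> over a field type \<open>'a\<close> is an element of \<open>carrier_vec N\<close>, so that lengths
  are ordinary natural numbers. The notions of subspace and dimension are those of the
  vector space \<open>module_vec TYPE('a) N\<close>.\<close>

definition hamming_dist :: "'a vec \<Rightarrow> 'a vec \<Rightarrow> nat" where
  "hamming_dist x y = card {i. i < dim_vec x \<and> x $ i \<noteq> y $ i}"

text \<open>Meaningful only for codes with at least two words, since \<open>Min {}\<close> is unspecified.\<close>

definition min_dist :: "'a vec set \<Rightarrow> nat" where
  "min_dist C = Min {hamming_dist x y | x y. x \<in> C \<and> y \<in> C \<and> x \<noteq> y}"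

definition linear_code :: "nat \<Rightarrow> 'a::field vec set \<Rightarrow> bool" where
  "linear_code N C \<longleftrightarrow> VectorSpace.subspace class_ring C (module_vec TYPE('a) N)"

definition code_dim :: "nat \<Rightarrow> 'a::field vec set \<Rightarrow> nat" where
  "code_dim N C = vectorspace.dim class_ring ((module_vec TYPE('a) N)\<lparr>carrier := C\<rparr>)"

definition has_parameters :: "'a::field vec set \<Rightarrow> nat \<Rightarrow> nat \<Rightarrow> nat \<Rightarrow> bool" where
  "has_parameters C N k d \<longleftrightarrow> linear_code N C \<and> code_dim N C = k \<and> min_dist C = d"

definition dual_code :: "nat \<Rightarrow> 'a::field vec set \<Rightarrow> 'a vec set" where
  "dual_code N C = {c \<in> carrier_vec N. \<forall>y\<in>C. c \<bullet> y = 0}"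

definition self_dual :: "nat \<Rightarrow> 'a::field vec set \<Rightarrow> bool" where
  "self_dual N C \<longleftrightarrow> C = dual_code N C"


section \<open>Cyclic codes\<close>

text \<open>The map sends \<open>(c\<^sub>0, \<dots>, c\<^sub>N\<^sub>-\<^sub>1)\<close> to \<open>(c\<^sub>N\<^sub>-\<^sub>1, c\<^sub>0, \<dots>, c\<^sub>N\<^sub>-\<^sub>2)\<close>.\<close>

definition cyclic_shift :: "'a vec \<Rightarrow> 'a vec" where
  "cyclic_shift c = vec (dim_vec c) (\<lambda>i. c $ ((i + dim_vec c - 1) mod dim_vec c))"

definition cyclic_code :: "nat \<Rightarrow> 'a::field vec set \<Rightarrow> bool" where
  "cyclic_code N C \<longleftrightarrow> linear_code N C \<and> (\<forall>c\<in>C. cyclic_shift c \<in> C)"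

definition code_poly :: "'a::comm_monoid_add vec \<Rightarrow> 'a poly" where
  "code_poly c = (\<Sum>i<dim_vec c. monom (c $ i) i)"

abbreviation x_pow_minus_1 :: "nat \<Rightarrow> 'a::comm_ring_1 poly" where
  "x_pow_minus_1 N \<equiv> monom 1 N - 1"

text \<open>Elements of the quotient ring by \<open>x^N - 1\<close> are represented by their residues of degree
  less than \<open>N\<close>. The code consists of the words whose class lies in the principal ideal of \<open>g\<close>.\<close>

definition code_generated_by :: "nat \<Rightarrow> 'a::field poly \<Rightarrow> 'a vec set" where
  "code_generated_by N g =
     {c \<in> carrier_vec N. \<exists>a. code_poly c = (a * g) mod x_pow_minus_1 N}"

definition is_generator_poly :: "nat \<Rightarrow> 'a::field vec set \<Rightarrow> 'a poly \<Rightarrow> bool" where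
  "is_generator_poly N C g \<longleftrightarrow>
     lead_coeff g = 1 \<and> g dvd x_pow_minus_1 N \<and> C = code_generated_by N g"

definition generator_poly :: "nat \<Rightarrow> 'a::field vec set \<Rightarrow> 'a poly" where
  "generator_poly N C = (THE g. is_generator_poly N C g)"


section \<open>BCH codes\<close>

definition primitive_root_of_unity :: "nat \<Rightarrow> 'b::field \<Rightarrow> bool" where
  "primitive_root_of_unity n \<beta> \<longleftrightarrow> n > 0 \<and> \<beta> ^ n = 1 \<and> (\<forall>k. 0 < k \<and> k < n \<longrightarrow> \<beta> ^ k \<noteq> 1)"

text \<open>Here \<open>emb\<close> is the embedding of the base field \<open>'a\<close> into the extension field \<open>'b\<close>.\<close>

definition min_poly :: "('a::field \<Rightarrow> 'b::field) \<Rightarrow> 'b \<Rightarrow> 'a poly" where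
  "min_poly emb x =
     (THE p. lead_coeff p = 1 \<and> poly (map_poly emb p) x = 0 \<and>
       (\<forall>r. r \<noteq> 0 \<and> poly (map_poly emb r) x = 0 \<longrightarrow> degree p \<le> degree r))"

text \<open>The sort \<open>field_gcd\<close> makes the library's \<open>Lcm\<close> available on \<open>'a poly\<close>, normalised to be
  monic. It does not restrict the field: every field carries the required (trivial) structure.\<close>

definition bch_poly :: "('a::field_gcd \<Rightarrow> 'b::field) \<Rightarrow> nat \<Rightarrow> int \<Rightarrow> 'b \<Rightarrow> 'a poly" where
  "bch_poly emb \<delta> b \<beta> = Lcm ((\<lambda>i. min_poly emb (\<beta> powi i)) ` {b..b + int \<delta> - 2})"

definition bch_code :: "('a::field_gcd \<Rightarrow> 'b::field) \<Rightarrow> nat \<Rightarrow> nat \<Rightarrow> int \<Rightarrow> 'b \<Rightarrow> 'a vec set" where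
  "bch_code emb n \<delta> b \<beta> = code_generated_by n (bch_poly emb \<delta> b \<beta>)"

text \<open>\<open>reflect_poly h\<close> is \<open>x^(degree h) h(1/x)\<close>.\<close>

definition monic_reciprocal :: "'a::field poly \<Rightarrow> 'a poly" where
  "monic_reciprocal h = Polynomial.smult (1 / poly h 0) (reflect_poly h)"

end

theory Submission
  imports
    Defs
    "Jordan_Normal_Form.Char_Poly"
    "HOL-Number_Theory.Cong"
begin

text \<open>Orthogonality of \<open>c\<close> to a cyclic code is a statement about one coefficient of a product of
  polynomials, which identifies duals of cyclic codes with their reciprocal check polynomials and
  makes \<open>g g\<^sup>\<bottom>\<close> self-reciprocal in this sense. The BCH code contains its dual: the roots of \<open>g\<close>
  are \<open>\<beta>^(i q^k)\<close> with \<open>1 \<le> i \<le> q^(m/2) - 2\<close>, and \<open>i q^k + j\<close> with \<open>k \<le> m/2\<close> is too small to be a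
  multiple of \<open>q^m - 1\<close>, so \<open>g\<close> and its reciprocal share no root. Hence \<open>g\<^sup>\<bottom> = g f\<close>, and \<open>g\<^sup>2 f\<close>
  generates a code of length \<open>2n\<close> of van Lint's \<open>u | u + v\<close> type with \<open>u\<close> in the code of \<open>g\<close> and
  \<open>v\<close> in the code of \<open>g f\<close>.\<close>

section \<open>Words and polynomials\<close>

text \<open>The value of \<delta> is the largest for which \<open>g\<close> can avoid its
  reciprocal. With \<open>Q = q^(m/2)\<close>, exponents up to \<open>Q - 2\<close> give
  \<open>i Q + j\<close> at most \<open>Q^2 - Q - 2\<close>, whereas \<open>i = j = Q - 1\<close>
  would give exactly \<open>Q^2 - 1\<close>. The restriction to \<open>k \<le> m/2\<close> is
  harmless: multiplying a relation modulo \<open>q^m - 1\<close> by a power of \<open>q\<close>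
  rotates the exponents and can exchange the roles of \<open>i\<close> and \<open>j\<close>.

  The delicate half of the distance formula is the upper bound by the distance of the dual. A word
  of the code of \<open>g f\<close> must be lifted along reduction modulo \<open>x^n - 1\<close> to
  a multiple of \<open>g^2 f\<close> without gaining weight, although the obvious lift is divisible
  by \<open>g\<close> only once. The oddness of \<open>n\<close> provides the lift, characteristic 2
  provides the second factor.

  The final estimate needs only one BCH bound, because both codes in the minimum consist of
  multiples of \<open>g\<close>.\<close>

definition poly_word :: "nat \<Rightarrow> 'a::zero poly \<Rightarrow> 'a vec" where
  "poly_word N p = vec N (coeff p)"

lemma poly_word_carrier [simp]: "poly_word N p \<in> carrier_vec N"
  by (simp add: poly_word_def)

lemma coeff_code_poly: "coeff (code_poly c) i = (if i < dim_vec c then c $ i else 0)"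
  by (simp add: code_poly_def coeff_sum coeff_monom)

lemma degree_code_poly:
  assumes "c \<in> carrier_vec N" "N > 0"
  shows "degree (code_poly c) < N"
proof -
  have "degree (code_poly c) \<le> N - 1"
    using assms by (intro degree_le) (auto simp: coeff_code_poly)
  thus ?thesis using assms(2) by linarith
qed

lemma code_poly_poly_word: "degree p < N \<Longrightarrow> code_poly (poly_word N p) = p"
  by (intro poly_eqI) (auto simp: coeff_code_poly poly_word_def coeff_eq_0)

lemma poly_word_code_poly: "c \<in> carrier_vec N \<Longrightarrow> poly_word N (code_poly c) = c"
  by (intro eq_vecI) (auto simp: coeff_code_poly poly_word_def)

lemma code_poly_zero [simp]: "code_poly (0\<^sub>v N) = 0"
  by (intro poly_eqI) (auto simp: coeff_code_poly)

lemma code_poly_add: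
  assumes "c \<in> carrier_vec N" "e \<in> carrier_vec N"
  shows "code_poly (c + e) = code_poly c + code_poly e"
  using assms by (intro poly_eqI) (auto simp: coeff_code_poly)

lemma code_poly_minus:
  fixes c e :: "'a::ring vec"
  assumes "c \<in> carrier_vec N" "e \<in> carrier_vec N"
  shows "code_poly (c - e) = code_poly c - code_poly e"
  using assms by (intro poly_eqI) (auto simp: coeff_code_poly)

lemma code_poly_smult: "code_poly (a \<cdot>\<^sub>v c) = Polynomial.smult a (code_poly c)"
  by (intro poly_eqI) (auto simp: coeff_code_poly)

section \<open>The modulus \<open>x^N - 1\<close> and the codes of its divisors\<close>

lemma degree_x_pow_minus_1:
  assumes "N > 0"
  shows "degree (x_pow_minus_1 N :: 'a::comm_ring_1 poly) = N"
proof (rule antisym)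
  show "degree (x_pow_minus_1 N :: 'a poly) \<le> N"
    by (intro degree_diff_le degree_monom_le) simp
  show "N \<le> degree (x_pow_minus_1 N :: 'a poly)"
    using assms by (intro le_degree) (simp add: coeff_1)
qed

lemma lead_coeff_x_pow_minus_1:
  assumes "N > 0"
  shows "lead_coeff (x_pow_minus_1 N :: 'a::comm_ring_1 poly) = 1"
  unfolding degree_x_pow_minus_1[OF assms] using assms by (simp add: coeff_1)

lemma x_pow_minus_1_nonzero:
  assumes "N > 0"
  shows "(x_pow_minus_1 N :: 'a::comm_ring_1 poly) \<noteq> 0"
  using lead_coeff_x_pow_minus_1[OF assms, where 'a = 'a] by (metis leading_coeff_0_iff zero_neq_one)

lemma poly_0_x_pow_minus_1:
  "N > 0 \<Longrightarrow> poly (x_pow_minus_1 N :: 'a::comm_ring_1 poly) 0 = - 1"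
  by (simp add: poly_monom zero_power)

text \<open>Reduction modulo \<open>x^N - 1\<close> preserves divisibility by a divisor of
  \<open>x^N - 1\<close>, and a multiple of \<open>g\<close> of degree below \<open>N\<close> is its
  own remainder. This removes the quotient ring from all later arguments.\<close>

lemma code_generated_by_eq:
  fixes g :: "'a::field poly"
  assumes "g dvd x_pow_minus_1 N" "N > 0"
  shows "code_generated_by N g = {c \<in> carrier_vec N. g dvd code_poly c}"
proof -
  have "(\<exists>a. code_poly c = (a * g) mod x_pow_minus_1 N) \<longleftrightarrow> g dvd code_poly c"
    if c: "c \<in> carrier_vec N" for c
  proof
    assume "\<exists>a. code_poly c = (a * g) mod x_pow_minus_1 N"
    thus "g dvd code_poly c" using assms(1) by (auto intro!: dvd_mod)
  next
    assume "g dvd code_poly c"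
    then obtain b where b: "code_poly c = b * g" by (metis dvdE mult.commute)
    have "(b * g) mod x_pow_minus_1 N = b * g"
      using degree_code_poly[OF c assms(2)] assms(2) b
      by (intro mod_poly_less) (simp add: degree_x_pow_minus_1)
    thus "\<exists>a. code_poly c = (a * g) mod x_pow_minus_1 N" using b by metis
  qed
  thus ?thesis unfolding code_generated_by_def by auto
qed

lemma poly_word_in_code:
  fixes g :: "'a::field poly"
  assumes "g dvd x_pow_minus_1 N" "degree p < N" "g dvd p"
  shows "poly_word N p \<in> code_generated_by N g"
proof -
  have "N > 0" using assms(2) by simp
  thus ?thesis using assms by (simp add: code_generated_by_eq code_poly_poly_word)
qed

lemma code_generated_by_subset_iff:
  fixes f g :: "'a::field poly"
  assumes g: "g dvd x_pow_minus_1 N" and f: "f dvd x_pow_minus_1 N" and N: "N > 0"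
  shows "code_generated_by N f \<subseteq> code_generated_by N g \<longleftrightarrow> g dvd f"
proof
  assume sub: "code_generated_by N f \<subseteq> code_generated_by N g"
  have f0: "f \<noteq> 0" using f x_pow_minus_1_nonzero[OF N, where 'a = 'a] by auto
  show "g dvd f"
  proof (cases "degree f < N")
    case True
    hence "poly_word N f \<in> code_generated_by N g" using poly_word_in_code[OF f] sub by auto
    thus ?thesis using True by (simp add: code_generated_by_eq[OF g N] code_poly_poly_word)
  next
    \<comment> \<open>Here \<open>f\<close> is too long to be a word of its own code, but it is then
      \<open>x^N - 1\<close> up to a unit, so \<open>g\<close> divides it anyway.\<close>
    case False
    obtain e where e: "x_pow_minus_1 N = f * e" using f by (elim dvdE)
    have "e \<noteq> 0" using e x_pow_minus_1_nonzero[OF N, where 'a = 'a] by auto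
    hence "degree f + degree e = N"
      using degree_x_pow_minus_1[OF N, where 'a = 'a] f0 unfolding e by (simp add: degree_mult_eq)
    hence "is_unit e" using False \<open>e \<noteq> 0\<close> by (simp add: is_unit_iff_degree)
    thus ?thesis using g e by (simp add: dvd_mult_unit_iff)
  qed
next
  assume "g dvd f"
  thus "code_generated_by N f \<subseteq> code_generated_by N g"
    by (auto simp: code_generated_by_eq[OF g N] code_generated_by_eq[OF f N] intro: dvd_trans)
qed

lemma monic_dvd_antisym:
  fixes f g :: "'a::field poly"
  assumes "f dvd g" "g dvd f" "lead_coeff f = 1" "lead_coeff g = 1"
  shows "f = g"
proof -
  obtain a where a: "g = f * a" using assms(1) by (elim dvdE)
  obtain b where b: "f = g * b" using assms(2) by (elim dvdE)
  have f0: "f \<noteq> 0" using assms(3) by auto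
  have "f * 1 = f * (a * b)" using a b by (simp add: mult_ac)
  hence "a * b = 1" using f0 mult_left_cancel by metis
  hence "is_unit a" by (metis dvd_triv_left)
  then obtain c where c: "a = [:c:]" using is_unit_polyE by blast
  hence "lead_coeff g = lead_coeff f * c" unfolding a by (simp add: lead_coeff_mult)
  hence "c = 1" using assms by simp
  thus ?thesis using a c by simp
qed

lemma generator_poly_code_generated_by:
  fixes g :: "'a::field poly"
  assumes "lead_coeff g = 1" "g dvd x_pow_minus_1 N" "N > 0"
  shows "generator_poly N (code_generated_by N g) = g"
  unfolding generator_poly_def
proof (rule the_equality)
  show "is_generator_poly N (code_generated_by N g) g"
    using assms by (simp add: is_generator_poly_def)
  fix f assume "is_generator_poly N (code_generated_by N g) f"
  thus "f = g" unfolding is_generator_poly_def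
    using assms code_generated_by_subset_iff[OF _ _ assms(3)] by (metis monic_dvd_antisym subset_refl)
qed

lemma linear_code_generated_by:
  fixes g :: "'a::field poly"
  assumes "g dvd x_pow_minus_1 N" "N > 0"
  shows "linear_code N (code_generated_by N g)"
proof -
  interpret vectorspace "class_ring :: 'a ring" "module_vec TYPE('a) N" by (rule vec_vs)
  show ?thesis
    unfolding linear_code_def VectorSpace.subspace_def
  proof (intro conjI vectorspace_axioms submodule.intro module_axioms)
  qed (auto simp: module_vec_simps class_ring_simps code_generated_by_eq[OF assms]
        code_poly_add code_poly_smult dvd_smult)
qed

lemma cyclic_code_generated_by:
  fixes g :: "'a::field poly"
  assumes "g dvd x_pow_minus_1 N" "N > 0"
  shows "cyclic_code N (code_generated_by N g)"
  unfolding cyclic_code_def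
proof (intro conjI ballI linear_code_generated_by[OF assms])
  fix c assume "c \<in> code_generated_by N g"
  hence c: "c \<in> carrier_vec N" and dvd: "g dvd code_poly c"
    by (auto simp: code_generated_by_eq[OF assms])
  \<comment> \<open>Shifting is multiplication by \<open>x\<close>; the overflowing coefficient
    moves from position \<open>N\<close> to position 0 by subtracting a multiple of
    \<open>x^N - 1\<close>, which \<open>g\<close> divides.\<close>
  have "code_poly (cyclic_shift c)
      = pCons 0 (code_poly c) - Polynomial.smult (c $ (N - 1)) (x_pow_minus_1 N)"
  proof (rule poly_eqI)
    fix i
    have mod_pred: "(i + N - 1) mod N = i - 1" if "0 < i" "i < N"
    proof -
      have "i + N - 1 = (i - 1) + N" using that by simp
      also have "\<dots> mod N = i - 1" using that by (simp only: mod_add_self2) simp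
      finally show ?thesis .
    qed
    show "coeff (code_poly (cyclic_shift c)) i
      = coeff (pCons 0 (code_poly c) - Polynomial.smult (c $ (N - 1)) (x_pow_minus_1 N)) i"
      using c assms(2) mod_pred
      by (cases i; cases "i = N") (auto simp: coeff_code_poly cyclic_shift_def coeff_pCons coeff_1 coeff_monom)
  qed
  moreover have "pCons 0 (code_poly c) = [:0, 1:] * code_poly c" by simp
  ultimately have "g dvd code_poly (cyclic_shift c)"
    using dvd assms(1) by (metis dvd_diff dvd_mult dvd_smult)
  moreover have "cyclic_shift c \<in> carrier_vec N" using c by (simp add: cyclic_shift_def)
  ultimately show "cyclic_shift c \<in> code_generated_by N g"
    by (simp add: code_generated_by_eq[OF assms])
qed

text \<open>Multiplication by \<open>g\<close> is a linear bijection from the words of length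
  \<open>N - degree g\<close> onto the code.\<close>

lemma code_dim_generated_by:
  fixes g :: "'a::field poly"
  assumes g: "g dvd x_pow_minus_1 N" and N: "N > 0"
  shows "code_dim N (code_generated_by N g) = N - degree g"
proof -
  define k where "k = N - degree g"
  define T where "T = (\<lambda>v. poly_word N (code_poly v * g))"
  let ?C = "code_generated_by N g"
  let ?V = "module_vec TYPE('a) k"
  let ?W = "(module_vec TYPE('a) N)\<lparr>carrier := ?C\<rparr>"
  have xN0: "(x_pow_minus_1 N :: 'a poly) \<noteq> 0" by (rule x_pow_minus_1_nonzero[OF N])
  have g0: "g \<noteq> 0" using xN0 g by auto
  have deg_lt: "degree (code_poly v * g) < N" if "v \<in> carrier_vec k" for v
  proof (cases "code_poly v = 0")
    case False
    have "k > 0" using False that by (cases k) (auto simp: code_poly_def)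
    hence "degree (code_poly v) < k" by (rule degree_code_poly[OF that])
    thus ?thesis using False g0 by (simp add: degree_mult_eq k_def)
  qed (simp add: N)
  have T_in: "T v \<in> ?C" if "v \<in> carrier_vec k" for v
    unfolding T_def by (intro poly_word_in_code[OF g] deg_lt that) auto
  have inj: "inj_on T (carrier_vec k)"
  proof (rule inj_onI)
    fix u v assume u: "u \<in> carrier_vec k" and v: "v \<in> carrier_vec k" and "T u = T v"
    hence "code_poly u * g = code_poly v * g"
      unfolding T_def
      by (metis code_poly_poly_word[OF deg_lt[OF u]] code_poly_poly_word[OF deg_lt[OF v]])
    hence "code_poly u = code_poly v" using g0 by simp
    thus "u = v" by (metis poly_word_code_poly u v)
  qed
  have surj: "T ` carrier_vec k = ?C"
  proof (intro equalityI subsetI)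
    fix c assume "c \<in> ?C"
    hence c: "c \<in> carrier_vec N" and "g dvd code_poly c"
      by (auto simp: code_generated_by_eq[OF assms])
    then obtain b where b: "code_poly c = b * g" by (metis dvdE mult.commute)
    have "code_poly (poly_word k b) = b"
    \<comment> \<open>The zero polynomial is separate because \<open>degree b < k\<close> fails for
      it when \<open>k = 0\<close>.\<close>
    proof (cases "b = 0")
      case False
      have "degree b < k"
        using degree_code_poly[OF c N] False g0 by (simp add: b degree_mult_eq k_def)
      thus ?thesis by (rule code_poly_poly_word)
    qed (simp add: poly_word_def code_poly_def)
    hence "T (poly_word k b) = c"
      unfolding T_def using poly_word_code_poly[OF c] b by simp
    thus "c \<in> T ` carrier_vec k" by (intro image_eqI[of _ _ "poly_word k b"]) auto
  qed (use T_in in auto)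
  interpret VN: vectorspace "class_ring :: 'a ring" "module_vec TYPE('a) N" by (rule vec_vs)
  interpret V: vec_space "TYPE('a)" k .
  have sub: "VectorSpace.subspace class_ring ?C (module_vec TYPE('a) N)"
    using linear_code_generated_by[OF assms] by (simp add: linear_code_def)
  interpret W: vectorspace "class_ring :: 'a ring" ?W by (rule VN.subspace_is_vs[OF sub])
  have T_add: "T (u + v) = T u + T v" if "u \<in> carrier_vec k" "v \<in> carrier_vec k" for u v
    using that by (auto simp: T_def poly_word_def code_poly_add[OF that] distrib_right)
  have T_smult: "T (a \<cdot>\<^sub>v v) = a \<cdot>\<^sub>v T v" for a v
    by (auto simp: T_def poly_word_def code_poly_smult)
  have "T \<in> LinearCombinations.module_hom class_ring ?V ?W"
    by (auto simp: LinearCombinations.module_hom_def module_vec_simps class_ring_simps T_add T_smult T_in)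
  then interpret L: linear_map "class_ring :: 'a ring" ?V ?W T
    by (intro linear_map.intro V.vectorspace_axioms W.vectorspace_axioms mod_hom.intro
      mod_hom_axioms.intro V.module_axioms W.module_axioms) 
  have "V.dim = W.dim"
    using inj surj by (intro L.dim_eq V.fin_dim) (simp_all add: module_vec_simps)
  hence "W.dim = k" by (metis V.dim_is_n)
  thus ?thesis by (simp add: code_dim_def k_def)
qed

section \<open>Weights and minimum distance\<close>

definition poly_weight :: "'a::zero poly \<Rightarrow> nat" where
  "poly_weight p = card {i. coeff p i \<noteq> 0}"

lemma support_subset: "degree p < N \<Longrightarrow> {i. coeff p i \<noteq> 0} \<subseteq> {..<N}"
  using le_degree by fastforce

lemma finite_support: "finite {i. coeff p i \<noteq> 0}"
  using support_subset[of p "Suc (degree p)"] finite_subset by blast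

lemma poly_weight_le: "degree p < N \<Longrightarrow> poly_weight p \<le> N"
  unfolding poly_weight_def using card_mono[OF _ support_subset] by fastforce

lemma hamming_dist_eq_poly_weight:
  fixes x y :: "'a::ring vec"
  assumes "x \<in> carrier_vec N" "y \<in> carrier_vec N"
  shows "hamming_dist x y = poly_weight (code_poly (x - y))"
  unfolding hamming_dist_def poly_weight_def
  using assms by (intro arg_cong[of _ _ card]) (auto simp: coeff_code_poly)

lemma hamming_dists_generated_by:
  fixes g :: "'a::field poly"
  assumes g: "g dvd x_pow_minus_1 N" and N: "N > 0"
  defines "C \<equiv> code_generated_by N g"
  shows "{hamming_dist x y | x y. x \<in> C \<and> y \<in> C \<and> x \<noteq> y}
    = poly_weight ` {p. p \<noteq> 0 \<and> degree p < N \<and> g dvd p}"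
proof (intro equalityI subsetI)
  fix d assume "d \<in> {hamming_dist x y | x y. x \<in> C \<and> y \<in> C \<and> x \<noteq> y}"
  then obtain x y where d: "d = hamming_dist x y" and "x \<in> C" "y \<in> C" and xy: "x \<noteq> y" by auto
  hence x: "x \<in> carrier_vec N" "g dvd code_poly x" and y: "y \<in> carrier_vec N" "g dvd code_poly y"
    by (auto simp: C_def code_generated_by_eq[OF g N])
  have "code_poly (x - y) \<noteq> 0"
    using xy by (metis code_poly_minus eq_iff_diff_eq_0 poly_word_code_poly x(1) y(1))
  moreover have "degree (code_poly (x - y)) < N"
    using x y by (intro degree_code_poly N) auto
  moreover have "g dvd code_poly (x - y)"
    using x y by (simp add: code_poly_minus dvd_diff)
  ultimately show "d \<in> poly_weight ` {p. p \<noteq> 0 \<and> degree p < N \<and> g dvd p}"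
    unfolding d hamming_dist_eq_poly_weight[OF x(1) y(1)] by auto
next
  fix d assume "d \<in> poly_weight ` {p. p \<noteq> 0 \<and> degree p < N \<and> g dvd p}"
  then obtain p where p: "p \<noteq> 0" "degree p < N" "g dvd p" and d: "d = poly_weight p" by auto
  have cp: "code_poly (poly_word N p) = p" by (rule code_poly_poly_word[OF p(2)])
  have 0: "0\<^sub>v N \<in> C" by (simp add: C_def code_generated_by_eq[OF g N])
  have "poly_word N p - 0\<^sub>v N = poly_word N p" by (rule minus_zero_vec) simp
  hence "d = hamming_dist (poly_word N p) (0\<^sub>v N)"
    unfolding d by (simp add: hamming_dist_eq_poly_weight[of _ N] cp)
  moreover have "poly_word N p \<noteq> 0\<^sub>v N" using cp p(1) by auto
  moreover have "poly_word N p \<in> C" unfolding C_def by (rule poly_word_in_code[OF g p(2,3)])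
  ultimately show "d \<in> {hamming_dist x y | x y. x \<in> C \<and> y \<in> C \<and> x \<noteq> y}" using 0 by blast
qed

lemma min_dist_le:
  fixes g :: "'a::field poly"
  assumes "g dvd x_pow_minus_1 N" "p \<noteq> 0" "degree p < N" "g dvd p"
  shows "min_dist (code_generated_by N g) \<le> poly_weight p"
proof -
  have N: "N > 0" using assms(3) by simp
  have "finite (poly_weight ` {p. p \<noteq> 0 \<and> degree p < N \<and> g dvd p})"
    by (rule finite_subset[of _ "{..N}"]) (auto intro: poly_weight_le)
  thus ?thesis
    unfolding min_dist_def hamming_dists_generated_by[OF assms(1) N]
    using assms by (intro Min_le) auto
qed

text \<open>The bound on \<open>degree g\<close> makes \<open>g\<close> itself a nonzero word, so
  that the \<open>Min\<close> in \<open>min_dist\<close> ranges over a nonempty set.\<close>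

lemma min_dist_attained:
  fixes g :: "'a::field poly"
  assumes "g dvd x_pow_minus_1 N" "degree g < N"
  obtains p where "p \<noteq> 0" "degree p < N" "g dvd p"
    "poly_weight p = min_dist (code_generated_by N g)"
proof -
  let ?S = "{p. p \<noteq> 0 \<and> degree p < N \<and> g dvd p}"
  have N: "N > 0" using assms(2) by simp
  have "g \<noteq> 0" using assms(1) x_pow_minus_1_nonzero[OF N, where 'a = 'a] by auto
  hence "g \<in> ?S" using assms by auto
  moreover have "finite (poly_weight ` ?S)"
    by (rule finite_subset[of _ "{..N}"]) (auto intro: poly_weight_le)
  ultimately have "Min (poly_weight ` ?S) \<in> poly_weight ` ?S" by (intro Min_in) auto
  thus thesis
    using that unfolding min_dist_def hamming_dists_generated_by[OF assms(1) N] by auto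
qed

section \<open>Duals of cyclic codes\<close>

definition rev_word :: "'a vec \<Rightarrow> 'a vec" where
  "rev_word c = vec (dim_vec c) (\<lambda>i. c $ (dim_vec c - 1 - i))"

lemma rev_word_carrier [simp]: "c \<in> carrier_vec N \<Longrightarrow> rev_word c \<in> carrier_vec N"
  by (simp add: rev_word_def)

lemma rev_word_rev_word [simp]: "rev_word (rev_word c) = c"
  by (intro eq_vecI) (auto simp: rev_word_def)

text \<open>Reversal takes place within \<open>N\<close> positions, \<open>reflect_poly\<close> only
  within the degree; the monomial makes up for the vanishing top coefficients.\<close>

lemma code_poly_rev_word:
  fixes c :: "'a::comm_ring_1 vec"
  assumes c: "c \<in> carrier_vec N" and N: "N > 0"
  shows "code_poly (rev_word c)
    = monom 1 (N - 1 - degree (code_poly c)) * reflect_poly (code_poly c)"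
proof (rule poly_eqI)
  fix i
  let ?P = "code_poly c"
  have deg: "degree ?P < N" by (rule degree_code_poly[OF c N])
  have "coeff ?P (N - 1 - i) = 0" if "i < N - 1 - degree ?P"
    using that by (intro coeff_eq_0) linarith
  moreover have "degree ?P - (i - (N - 1 - degree ?P)) = N - 1 - i" if "\<not> i < N - 1 - degree ?P"
    using that deg by linarith
  moreover have "i - (N - 1 - degree ?P) > degree ?P \<longleftrightarrow> i \<ge> N" if "\<not> i < N - 1 - degree ?P"
    using that deg by linarith
  ultimately show "coeff (code_poly (rev_word c)) i
      = coeff (monom 1 (N - 1 - degree ?P) * reflect_poly ?P) i"
    using c N by (auto simp: coeff_code_poly rev_word_def coeff_monom_mult coeff_reflect_poly)
qed

lemma reflect_poly_dvd_rev_word: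
  fixes h :: "'a::field poly"
  assumes c: "c \<in> carrier_vec N" and N: "N > 0" and dvd: "h dvd code_poly c"
  shows "reflect_poly h dvd code_poly (rev_word c)"
proof -
  obtain a where "code_poly c = h * a" using dvd by (elim dvdE)
  thus ?thesis by (simp add: code_poly_rev_word[OF c N] reflect_poly_mult)
qed

text \<open>Reflection is multiplicative, and it is an involution on polynomials with nonzero
  constant term, which gives both directions.\<close>

lemma dvd_rev_word_iff:
  fixes h :: "'a::field poly"
  assumes c: "c \<in> carrier_vec N" and N: "N > 0" and h0: "poly h 0 \<noteq> 0"
  shows "h dvd code_poly (rev_word c) \<longleftrightarrow> monic_reciprocal h dvd code_poly c"
proof -
  have "h dvd code_poly (rev_word c) \<longleftrightarrow> reflect_poly h dvd code_poly c"
    using reflect_poly_dvd_rev_word[of "rev_word c" N h]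
      reflect_poly_dvd_rev_word[of c N "reflect_poly h"] c N h0
    by (auto simp: poly_0_coeff_0)
  thus ?thesis unfolding monic_reciprocal_def using h0 by (simp add: smult_dvd_iff)
qed

lemma scalar_prod_eq_coeff:
  fixes c y :: "'a::comm_ring_1 vec"
  assumes "c \<in> carrier_vec N" "y \<in> carrier_vec N" "N > 0"
  shows "c \<bullet> y = coeff (code_poly (rev_word c) * code_poly y) (N - 1)"
proof -
  have "coeff (code_poly (rev_word c) * code_poly y) (N - 1)
      = (\<Sum>i\<le>N-1. coeff (code_poly y) i * coeff (code_poly (rev_word c)) (N - 1 - i))"
    by (subst mult.commute) (rule coeff_mult)
  also have "\<dots> = (\<Sum>i\<in>{0..<N}. c $ i * y $ i)"
    using assms by (intro sum.cong) (auto simp: coeff_code_poly rev_word_def mult.commute)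
  finally show ?thesis using assms by (simp add: scalar_prod_def)
qed

lemma reflect_poly_x_pow_minus_1:
  assumes N: "N > 0"
  shows "reflect_poly (x_pow_minus_1 N :: 'a::comm_ring_1 poly) = - x_pow_minus_1 N"
proof (rule poly_eqI)
  fix i
  show "coeff (reflect_poly (x_pow_minus_1 N :: 'a poly)) i = coeff (- x_pow_minus_1 N) i"
    using N unfolding coeff_reflect_poly degree_x_pow_minus_1[OF N] by (auto simp: coeff_1)
qed

text \<open>Since \<open>c \<bullet> y\<close> is the coefficient of \<open>x^(N-1)\<close> in the product of the reversed
  polynomial of \<open>c\<close> with that of \<open>y\<close>, orthogonality to all shifts of \<open>g\<close> kills the remainder
  of the reversed polynomial modulo \<open>h\<close>.\<close>

lemma dual_code_generated_by:
  fixes g h :: "'a::field poly"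
  assumes gh: "g * h = x_pow_minus_1 N" and N: "N > 0"
  shows "dual_code N (code_generated_by N g) = code_generated_by N (monic_reciprocal h)"
    and "monic_reciprocal h dvd x_pow_minus_1 N"
    and "lead_coeff (monic_reciprocal h) = 1"
    and "degree (monic_reciprocal h) = degree h"
proof -
  have xN0: "(x_pow_minus_1 N :: 'a poly) \<noteq> 0" by (rule x_pow_minus_1_nonzero[OF N])
  have g0: "g \<noteq> 0" and hn0: "h \<noteq> 0" using xN0 gh[symmetric] by auto
  have gdvd: "g dvd x_pow_minus_1 N" using gh[symmetric] by simp
  have "poly g 0 * poly h 0 = - 1"
    using arg_cong[OF gh, of "\<lambda>p. poly p 0"] poly_0_x_pow_minus_1[OF N, where 'a = 'a] by simp
  hence h0: "poly h 0 \<noteq> 0" by auto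
  have deg: "degree g + degree h = N"
    using degree_mult_eq[OF g0 hn0] degree_x_pow_minus_1[OF N, where 'a = 'a] by (simp add: gh)
  show degr: "degree (monic_reciprocal h) = degree h"
    using h0 by (simp add: monic_reciprocal_def poly_0_coeff_0)
  show "lead_coeff (monic_reciprocal h) = 1"
    unfolding degr using h0 by (simp add: monic_reciprocal_def coeff_reflect_poly poly_0_coeff_0)
  note reflect_poly_x_pow_minus_1[OF N, where 'a = 'a]
  hence "reflect_poly g * reflect_poly h = - x_pow_minus_1 N"
    by (simp flip: reflect_poly_mult add: gh)
  hence "reflect_poly h dvd x_pow_minus_1 N"
    by (metis dvd_minus_iff dvd_triv_right)
  thus rdvd: "monic_reciprocal h dvd x_pow_minus_1 N"
    unfolding monic_reciprocal_def using h0 by (simp add: smult_dvd_iff)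
  have "(\<forall>y\<in>code_generated_by N g. c \<bullet> y = 0) \<longleftrightarrow> h dvd code_poly (rev_word c)"
    if c: "c \<in> carrier_vec N" for c
  proof
    assume dvd: "h dvd code_poly (rev_word c)"
    show "\<forall>y\<in>code_generated_by N g. c \<bullet> y = 0"
    proof
      fix y assume "y \<in> code_generated_by N g"
      hence y: "y \<in> carrier_vec N" and "g dvd code_poly y"
        by (auto simp: code_generated_by_eq[OF gdvd N])
      with dvd have "g * h dvd code_poly y * code_poly (rev_word c)" by (intro mult_dvd_mono)
      then obtain e where e: "code_poly (rev_word c) * code_poly y = x_pow_minus_1 N * e"
        unfolding gh by (metis dvdE mult.commute)
      \<comment> \<open>The product has degree at most \<open>2N - 2\<close>, so \<open>e\<close>
        has degree at most \<open>N - 2\<close>; hence neither \<open>x^N e\<close> nor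
        \<open>- e\<close> reaches the coefficient at \<open>N - 1\<close>.\<close>
      have "degree (code_poly (rev_word c) * code_poly y) \<le> (N - 1) + (N - 1)"
        using degree_code_poly[OF rev_word_carrier[OF c] N] degree_code_poly[OF y N]
        by (intro order_trans[OF degree_mult_le] add_mono) auto
      hence "e = 0 \<or> N + degree e \<le> (N - 1) + (N - 1)"
        using degree_mult_eq[OF xN0, of e] unfolding e degree_x_pow_minus_1[OF N] by metis
      hence "e = 0 \<or> degree e < N - 1" using N by linarith
      hence "coeff e (N - 1) = 0" by (auto intro: coeff_eq_0)
      hence "coeff (x_pow_minus_1 N * e) (N - 1) = 0"
        using N by (simp add: left_diff_distrib coeff_monom_mult)
      thus "c \<bullet> y = 0" by (simp only: scalar_prod_eq_coeff[OF c y N] e)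
    qed
  next
    assume orth: "\<forall>y\<in>code_generated_by N g. c \<bullet> y = 0"
    define P where "P = code_poly (rev_word c)"
    define r where "r = P mod h"
    have coeff0: "coeff (P * b * g) (N - 1) = 0" if "degree (b * g) < N" for b
    proof -
      have "poly_word N (b * g) \<in> code_generated_by N g"
        by (rule poly_word_in_code[OF gdvd that]) simp
      hence "c \<bullet> poly_word N (b * g) = 0" using orth by blast
      thus ?thesis
        by (simp add: scalar_prod_eq_coeff[OF c _ N] code_poly_poly_word[OF that] P_def mult_ac)
    qed
    have "r = 0"
    proof (rule ccontr)
      assume r0: "r \<noteq> 0"
      hence degr: "degree r < degree h" unfolding r_def using hn0 by (metis degree_mod_less)
      \<comment> \<open>The shift is chosen so that \<open>r * g * b\<close> has degree exactly
        \<open>N - 1\<close>: its leading coefficient is then the one that orthogonality forces to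
        vanish.\<close>
      define e where "e = N - 1 - degree (r * g)"
      have drg: "degree (r * g) = degree r + degree g" by (rule degree_mult_eq[OF r0 g0])
      define b :: "'a poly" where "b = monom 1 e"
      have b0: "b \<noteq> 0" by (simp add: b_def monom_eq_0_iff)
      have degb: "degree b = e" by (simp add: b_def degree_monom_eq)
      have degbg: "degree (b * g) < N"
        unfolding degree_mult_eq[OF b0 g0] degb e_def drg using degr deg by linarith
      have Peq: "P = h * (P div h) + r" by (simp add: r_def)
      have "(h * s + r) * b * g = x_pow_minus_1 N * (s * b) + r * g * b" for s
        unfolding gh[symmetric] by (simp add: algebra_simps)
      hence "P * b * g = x_pow_minus_1 N * ((P div h) * b) + r * g * b" using Peq by metis
      \<comment> \<open>The quotient part is invisible at \<open>N - 1\<close>: as \<open>P\<close>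
        has degree below \<open>N\<close>, the factor multiplying \<open>x^N - 1\<close> has degree
        below \<open>N - 1\<close>.\<close>
      moreover have "coeff (x_pow_minus_1 N * ((P div h) * b)) (N - 1) = 0"
      proof -
        have "degree P < N" unfolding P_def by (rule degree_code_poly[OF rev_word_carrier[OF c] N])
        have "(P div h) * b = 0 \<or> degree ((P div h) * b) < N - 1"
        proof (cases "P div h = 0")
          case False
          have "degree (h * (P div h)) \<le> max (degree P) (degree r)"
            using degree_diff_le_max[of P r] Peq by (metis add_diff_cancel_right')
          hence "degree (P div h) + degree h \<le> degree P"
            using degr degree_mult_eq[OF hn0 False] by linarith
          hence "degree (P div h) + e < N - 1" 
            unfolding e_def drg using \<open>degree P < N\<close> deg degr by linarith
          thus ?thesis using degree_mult_eq[OF False b0] degb by simp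
        qed simp
        hence "coeff ((P div h) * b) (N - 1) = 0" by (auto intro: coeff_eq_0)
        thus ?thesis using N by (simp add: left_diff_distrib coeff_monom_mult)
      qed
      moreover have "coeff (r * g * b) (N - 1) \<noteq> 0"
      proof -
        have "coeff (r * g * b) (N - 1) = coeff (r * g * b) (degree (r * g * b))"
          using degr deg by (intro arg_cong[of _ _ "coeff (r * g * b)"])
            (simp add: degree_mult_eq r0 g0 b0 degb e_def)
        thus ?thesis using r0 g0 b0 by (metis leading_coeff_0_iff mult_eq_0_iff)
      qed
      ultimately show False using coeff0[OF degbg] by simp
    qed
    thus "h dvd code_poly (rev_word c)" by (simp add: r_def P_def dvd_eq_mod_eq_0)
  qed
  thus "dual_code N (code_generated_by N g) = code_generated_by N (monic_reciprocal h)"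
    using dvd_rev_word_iff[OF _ N h0]
    by (auto simp: dual_code_def code_generated_by_eq[OF rdvd N])
qed

section \<open>Repeated-root cyclic codes of length \<open>2n\<close> in characteristic 2\<close>

text \<open>This is \<open>x F' - n F = n\<close> for \<open>F = x^n - 1\<close>, with
  \<open>F'\<close> expanded by the product rule. If \<open>n\<close> is nonzero in the field, the
  right side is a unit, so the factors of \<open>F\<close> are coprime and squarefree.\<close>

lemma Bezout_x_pow_minus_1:
  fixes a b :: "'a::field_gcd poly"
  assumes "a * b = x_pow_minus_1 n"
  shows "[:0, 1:] * (pderiv a * b + a * pderiv b) - of_nat n * (a * b) = of_nat n"
proof (cases "n = 0")
  case True
  hence "a * b = 0" using assms by (simp add: monom_0)
  thus ?thesis using True by auto
next
  case False
  have "pderiv a * b + a * pderiv b = pderiv (x_pow_minus_1 n)"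
    unfolding assms[symmetric] by (simp add: pderiv_mult mult_ac)
  also have "\<dots> = monom (of_nat n) (n - 1)" by (simp add: pderiv_diff pderiv_monom)
  finally have "[:0, 1:] * (pderiv a * b + a * pderiv b) = monom (of_nat n) n"
    using False by (simp add: x_as_monom mult_monom)
  also have "\<dots> = of_nat n * monom 1 n"
    by (simp add: of_nat_poly smult_monom)
  finally show ?thesis unfolding assms by (simp add: algebra_simps)
qed

lemma coprime_factors_x_pow_minus_1:
  fixes a b :: "'a::field_gcd poly"
  assumes ab: "a * b = x_pow_minus_1 n" and n: "of_nat n \<noteq> (0::'a)"
  shows "coprime a b" and "coprime a (pderiv a)"
proof -
  have unit: "is_unit (of_nat n :: 'a poly)"
    using n by (simp add: of_nat_poly is_unit_const_poly_iff)
  have "is_unit c" if "c dvd a" "c dvd b \<or> c dvd pderiv a" for c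
  proof -
    have "c dvd [:0, 1:] * (pderiv a * b + a * pderiv b) - of_nat n * (a * b)"
      using that by (metis dvd_add dvd_diff dvd_mult dvd_mult2)
    thus ?thesis unfolding Bezout_x_pow_minus_1[OF ab] using unit by (rule dvd_unit_imp_unit)
  qed
  thus "coprime a b" "coprime a (pderiv a)" by (blast intro: coprimeI)+
qed

text \<open>These are the \<open>u | u + v\<close> coordinates: \<open>r\<close> is the upper half
  of \<open>p\<close> and \<open>v\<close> the sum of the two halves, that is, \<open>p\<close>
  modulo \<open>x^n - 1\<close>.\<close>

lemma poly_split:
  fixes p :: "'a::comm_ring_1 poly"
  assumes "degree p < 2 * n"
  obtains v r where "p = v + x_pow_minus_1 n * r" "degree v < n" "degree r < n"
    "\<And>i. i < n \<Longrightarrow> coeff v i = coeff p i + coeff p (i + n)"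
proof -
  define r where "r = poly_shift n p"
  define v where "v = poly_cutoff n p + r"
  have n: "n > 0" using assms by simp
  have r: "degree r < n"
  proof -
    have "degree r \<le> n - 1" unfolding r_def
      using assms by (intro degree_le) (auto simp: coeff_poly_shift intro!: coeff_eq_0)
    thus ?thesis using n by simp
  qed
  have "degree (poly_cutoff n p) \<le> n - 1"
    by (intro degree_le) (auto simp: coeff_poly_cutoff)
  hence v: "degree v < n" unfolding v_def using r n by (intro degree_add_less) auto
  have "p = poly_cutoff n p + monom 1 n * r"
    by (intro poly_eqI) (auto simp: r_def coeff_poly_cutoff coeff_poly_shift coeff_monom_mult)
  hence "p = v + x_pow_minus_1 n * r" by (simp add: v_def algebra_simps)
  moreover have "coeff v i = coeff p i + coeff p (i + n)" if "i < n" for i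
    using that by (simp add: v_def r_def coeff_poly_cutoff coeff_poly_shift add.commute)
  ultimately show thesis using that r v by blast
qed

lemma poly_weight_fold:
  assumes "degree v < n" "\<And>i. i < n \<Longrightarrow> coeff v i = coeff p i + coeff p (i + n)"
  shows "poly_weight v \<le> poly_weight (p :: 'a::comm_ring_1 poly)"
proof -
  have "{i. coeff v i \<noteq> 0} \<subseteq> (\<lambda>j. j mod n) ` {j. coeff p j \<noteq> 0}"
  proof
    fix i assume i: "i \<in> {i. coeff v i \<noteq> 0}"
    hence lt: "i < n" using support_subset[OF assms(1)] by auto
    hence "coeff p i \<noteq> 0 \<or> coeff p (i + n) \<noteq> 0" using i assms(2) by auto
    moreover have "i = i mod n" "i = (i + n) mod n" using lt by auto
    ultimately show "i \<in> (\<lambda>j. j mod n) ` {j. coeff p j \<noteq> 0}" by blast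
  qed
  hence "poly_weight v \<le> card ((\<lambda>j. j mod n) ` {j. coeff p j \<noteq> 0})"
    unfolding poly_weight_def by (intro card_mono finite_imageI finite_support)
  also have "\<dots> \<le> poly_weight p"
    unfolding poly_weight_def by (intro card_image_le finite_support)
  finally show ?thesis .
qed

lemma poly_weight_x_pow_minus_1_mult:
  fixes r :: "'a::comm_ring_1 poly"
  assumes "degree r < n"
  shows "poly_weight (x_pow_minus_1 n * r) = 2 * poly_weight r"
proof -
  let ?S = "{i. coeff r i \<noteq> 0}"
  have coeff: "coeff (x_pow_minus_1 n * r) i = (if n \<le> i then coeff r (i - n) else 0) - coeff r i" for i
    by (simp add: left_diff_distrib coeff_monom_mult)
  have S: "?S \<subseteq> {..<n}" by (rule support_subset[OF assms])
  have "{i. coeff (x_pow_minus_1 n * r) i \<noteq> 0} = ?S \<union> (\<lambda>i. i + n) ` ?S"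
  proof (intro equalityI subsetI)
    fix i assume i: "i \<in> {i. coeff (x_pow_minus_1 n * r) i \<noteq> 0}"
    show "i \<in> ?S \<union> (\<lambda>i. i + n) ` ?S"
    proof (cases "i < n")
      case False
      hence "coeff r i = 0" using assms by (intro coeff_eq_0) simp
      hence "i - n \<in> ?S" using i False by (simp add: coeff)
      thus ?thesis using False by (auto intro!: image_eqI[of _ _ "i - n"])
    qed (use i in \<open>auto simp: coeff\<close>)
  next
    fix i assume "i \<in> ?S \<union> (\<lambda>i. i + n) ` ?S"
    thus "i \<in> {i. coeff (x_pow_minus_1 n * r) i \<noteq> 0}"
      using S assms by (auto simp: coeff coeff_eq_0)
  qed
  moreover have "?S \<inter> (\<lambda>i. i + n) ` ?S = {}" using S by auto
  ultimately show ?thesis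
    unfolding poly_weight_def
    by (simp add: card_Un_disjoint finite_support card_image)
qed

text \<open>For odd \<open>n\<close> exactly one of \<open>i\<close> and \<open>i + n\<close> is
  even, so each coefficient of \<open>v\<close> has one even position below \<open>2 * n\<close>
  with the same residue modulo \<open>n\<close>.\<close>

definition spread_even :: "nat \<Rightarrow> 'a::comm_monoid_add poly \<Rightarrow> 'a poly" where
  "spread_even n v = code_poly (vec (2 * n) (\<lambda>i. if even i then coeff v (i mod n) else 0))"

lemma coeff_spread_even:
  "coeff (spread_even n v) i = (if i < 2 * n \<and> even i then coeff v (i mod n) else 0)"
  by (auto simp: spread_even_def coeff_code_poly)

lemma pderiv_spread_even:
  fixes v :: "'a::field_gcd poly"
  assumes "(2::'a) = 0"
  shows "pderiv (spread_even n v) = 0"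
proof (rule poly_eqI)
  fix i
  have even: "of_nat (Suc i) = (0::'a)" if ev: "even (Suc i)"
  proof -
    obtain k where "Suc i = 2 * k" using ev by (elim evenE)
    hence "of_nat (Suc i) = (2::'a) * of_nat k" by (metis of_nat_mult of_nat_numeral)
    thus ?thesis using assms by simp
  qed
  thus "coeff (pderiv (spread_even n v)) i = coeff 0 i"
    unfolding coeff_pderiv coeff_spread_even using even by (cases "even (Suc i)") simp_all
qed

lemma spread_even_props:
  fixes v :: "'a::field_gcd poly"
  assumes n: "odd n" and v: "degree v < n" "v \<noteq> 0"
  shows "degree (spread_even n v) < 2 * n" and "spread_even n v \<noteq> 0"
    and "x_pow_minus_1 n dvd spread_even n v - v"
    and "poly_weight (spread_even n v) \<le> poly_weight v"
proof -
  have n0: "n > 0" using n by (cases n) auto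
  show deg: "degree (spread_even n v) < 2 * n"
    unfolding spread_even_def using n0 by (intro degree_code_poly) auto
  obtain w r where wr: "spread_even n v = w + x_pow_minus_1 n * r" "degree w < n"
    and w: "\<And>i. i < n \<Longrightarrow> coeff w i = coeff (spread_even n v) i + coeff (spread_even n v) (i + n)"
    using poly_split[OF deg] by metis
  \<comment> \<open>In the sum of the coefficients at \<open>i\<close> and \<open>i + n\<close>
    exactly one term survives, by the parity of \<open>n\<close>.\<close>
  have "w = v"
  proof (rule poly_eqI)
    fix i
    show "coeff w i = coeff v i"
    proof (cases "i < n")
      case True
      thus ?thesis using n by (simp add: w coeff_spread_even)
    next
      case False
      thus ?thesis using wr(2) v(1) by (simp add: coeff_eq_0)
    qed
  qed
  thus dvd: "x_pow_minus_1 n dvd spread_even n v - v" using wr(1) by simp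
  show "spread_even n v \<noteq> 0"
  proof
    assume "spread_even n v = 0"
    hence "poly_weight v \<le> poly_weight (0 :: 'a poly)"
      using poly_weight_fold[OF wr(2) w] \<open>w = v\<close> by simp
    hence "{i. coeff v i \<noteq> 0} = {}" by (simp add: poly_weight_def finite_support)
    hence "lead_coeff v = 0" by blast
    thus False using v(2) by simp
  qed
  let ?E = "{i. coeff (spread_even n v) i \<noteq> 0}"
  have "inj_on (\<lambda>i. i mod n) ?E"
  proof (rule inj_onI)
    fix i j assume "i \<in> ?E" "j \<in> ?E" and eq: "i mod n = j mod n"
    hence ij: "i < 2 * n" "even i" "j < 2 * n" "even j" by (auto simp: coeff_spread_even split: if_splits)
    \<comment> \<open>Chinese remaindering: the exponents agree modulo \<open>n\<close> and modulo
      2, and \<open>n\<close> is odd.\<close>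
    have "[i = j] (mod n * 2)"
      using eq ij n by (intro coprime_cong_mult_nat) (auto simp: cong_def)
    thus "i = j" using ij by (simp add: cong_def mult.commute)
  qed
  moreover have "(\<lambda>i. i mod n) ` ?E \<subseteq> {i. coeff v i \<noteq> 0}"
    by (auto simp: coeff_spread_even split: if_splits)
  ultimately show "poly_weight (spread_even n v) \<le> poly_weight v"
    unfolding poly_weight_def by (intro card_inj_on_le finite_support)
qed

text \<open>Writing \<open>E = g e\<close>, the vanishing derivative gives
  \<open>g' e = - g e'\<close>; as \<open>g\<close> is coprime to \<open>g'\<close>, it divides
  \<open>e\<close>.\<close>

lemma dvd_imp_square_dvd:
  fixes g E :: "'a::field_gcd poly"
  assumes "coprime g (pderiv g)" "pderiv E = 0" "g dvd E"
  shows "g * g dvd E"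
proof -
  obtain e where e: "E = g * e" using assms(3) by (elim dvdE)
  have "pderiv g * e = - (g * pderiv e)"
    using assms(2) unfolding e pderiv_mult by (simp add: eq_neg_iff_add_eq_0 add.commute mult.commute)
  hence "g dvd pderiv g * e" by simp
  hence "g dvd e" using assms(1) by (simp add: coprime_dvd_mult_right_iff)
  thus ?thesis unfolding e by (rule mult_dvd_mono[OF dvd_refl])
qed

text \<open>Upper bounds: \<open>(x\<^sup>n - 1) r\<close> with \<open>r\<close> a minimum weight word for \<open>g\<close>, and a minimum
  weight word for \<open>g f\<close> moved to even exponents modulo \<open>x\<^sup>n - 1\<close>, whose derivative vanishes
  so that the factor \<open>g\<close> is doubled.\<close>

lemma min_dist_repeated_root:
  fixes g f :: "'a::field_gcd poly"
  assumes two: "(2::'a) = 0" and n: "odd n"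
    and dvd: "g * f dvd x_pow_minus_1 n" and deg: "degree (g * f) < n"
    and dvd2: "g * (g * f) dvd x_pow_minus_1 (2 * n)"
  shows "min_dist (code_generated_by (2 * n) (g * (g * f)))
    = min (2 * min_dist (code_generated_by n g)) (min_dist (code_generated_by n (g * f)))"
proof (rule antisym)
  have n0: "n > 0" using n by (cases n) auto
  have ofn: "of_nat n \<noteq> (0::'a)"
  proof -
    obtain k where k: "n = 2 * k + 1" using n by (elim oddE)
    have "of_nat n = (2::'a) * of_nat k + 1" unfolding k by simp
    thus ?thesis using two by simp
  qed
  obtain k where k: "g * f * k = x_pow_minus_1 n" using dvd by (metis dvdE)
  have gdvd: "g dvd x_pow_minus_1 n" using dvd by (rule dvd_mult_left)
  have xn0: "(x_pow_minus_1 n :: 'a poly) \<noteq> 0" by (rule x_pow_minus_1_nonzero[OF n0])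
  have nz: "g \<noteq> 0" "f \<noteq> 0" using xn0 dvd by auto
  have cop: "coprime g (f * k)" "coprime g (pderiv g)"
    using coprime_factors_x_pow_minus_1[of g "f * k" n] ofn k by (auto simp: mult.assoc)
  have degg: "degree g < n" using deg nz by (simp add: degree_mult_eq)
  have "2 * min_dist (code_generated_by n g) \<ge> min_dist (code_generated_by (2 * n) (g * (g * f)))"
  proof -
    obtain r where r: "r \<noteq> 0" "degree r < n" "g dvd r"
      "poly_weight r = min_dist (code_generated_by n g)"
      by (rule min_dist_attained[OF gdvd degg])
    have "min_dist (code_generated_by (2 * n) (g * (g * f))) \<le> poly_weight (x_pow_minus_1 n * r)"
    proof (rule min_dist_le[OF dvd2])
      show "x_pow_minus_1 n * r \<noteq> 0" using xn0 r(1) by simp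
      show "degree (x_pow_minus_1 n * r) < 2 * n"
        unfolding degree_mult_eq[OF xn0 r(1)] degree_x_pow_minus_1[OF n0] using r(2) by simp
      have "g * f * g dvd x_pow_minus_1 n * r" by (rule mult_dvd_mono[OF dvd r(3)])
      thus "g * (g * f) dvd x_pow_minus_1 n * r" by (simp add: mult_ac)
    qed
    thus ?thesis using poly_weight_x_pow_minus_1_mult[OF r(2)] r(4) by simp
  qed
  moreover have "min_dist (code_generated_by n (g * f)) \<ge> min_dist (code_generated_by (2 * n) (g * (g * f)))"
  proof -
    obtain v where v: "v \<noteq> 0" "degree v < n" "g * f dvd v"
      "poly_weight v = min_dist (code_generated_by n (g * f))"
      by (rule min_dist_attained[OF dvd deg])
    note E = spread_even_props[OF n v(2,1)]
    have "g * f dvd spread_even n v"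
      using dvd_trans[OF dvd E(3)] v(3) by (metis diff_add_cancel dvd_add)
    moreover from this have "g * g dvd spread_even n v"
      by (intro dvd_imp_square_dvd cop pderiv_spread_even two) (rule dvd_mult_left)
    moreover have "coprime g f" using cop(1) by simp
    \<comment> \<open>The two divisibilities overlap in one factor \<open>g\<close>; since
      \<open>g\<close> and \<open>f\<close> are coprime, they combine without losing it.\<close>
    ultimately have "g * (g * f) dvd spread_even n v"
    proof -
      assume "g * f dvd spread_even n v" "g * g dvd spread_even n v" "coprime g f"
      then obtain s t where st: "spread_even n v = g * f * s" "spread_even n v = g * g * t"
        by (metis dvdE)
      hence "f * s = g * t" using nz(1) by (simp add: mult.assoc)
      hence "g dvd f * s" by simp
      hence "g dvd s" using \<open>coprime g f\<close> by (simp add: coprime_dvd_mult_right_iff)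
      thus ?thesis unfolding st(1) by (metis mult.commute mult_dvd_mono dvd_refl)
    qed
    from min_dist_le[OF dvd2 E(2,1) this] E(4) v(4) show ?thesis by simp
  qed
  ultimately show "min_dist (code_generated_by (2 * n) (g * (g * f)))
    \<le> min (2 * min_dist (code_generated_by n g)) (min_dist (code_generated_by n (g * f)))" by simp

  have deg2: "degree (g * (g * f)) < 2 * n"
    using degree_mult_eq[OF nz(1), of "g * f"] nz deg degg by simp
  obtain p where p: "p \<noteq> 0" "degree p < 2 * n" "g * (g * f) dvd p"
    "poly_weight p = min_dist (code_generated_by (2 * n) (g * (g * f)))"
    by (rule min_dist_attained[OF dvd2 deg2])
  obtain v r where vr: "p = v + x_pow_minus_1 n * r" "degree v < n" "degree r < n"
    and v: "\<And>i. i < n \<Longrightarrow> coeff v i = coeff p i + coeff p (i + n)"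
    using poly_split[OF p(2)] by metis
  show "min (2 * min_dist (code_generated_by n g)) (min_dist (code_generated_by n (g * f)))
    \<le> min_dist (code_generated_by (2 * n) (g * (g * f)))"
  proof (cases "v = 0")
    case True
    hence r0: "r \<noteq> 0" using p(1) vr(1) by auto
    \<comment> \<open>When the folded part vanishes, \<open>x^n - 1\<close> supplies
      \<open>g f\<close>, and the remaining factor \<open>g\<close> must come from \<open>r\<close>,
      because it is coprime to \<open>k\<close>.\<close>
    have "p = g * f * (k * r)" using True vr(1) unfolding k[symmetric] by (simp add: mult.assoc)
    moreover have "g * f * g dvd p" using p(3) by (simp add: mult_ac)
    ultimately have "g * f * g dvd g * f * (k * r)" by simp
    hence "g dvd k * r" using nz by (simp only: dvd_mult_cancel_left) simp
    moreover have "coprime g k" using cop(1) by simp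
    ultimately have "g dvd r" by (simp add: coprime_dvd_mult_right_iff)
    hence "2 * min_dist (code_generated_by n g) \<le> 2 * poly_weight r"
      using min_dist_le[OF gdvd r0 vr(3)] by simp
    also have "\<dots> = poly_weight p"
      using True vr(1) poly_weight_x_pow_minus_1_mult[OF vr(3)] by simp
    finally show ?thesis using p(4) by simp
  next
    case False
    \<comment> \<open>Folding subtracts a multiple of \<open>x^n - 1\<close>, which is known to
      contain \<open>g f\<close> only; hence the second factor \<open>g\<close> is not
      retained.\<close>
    have "g * f dvd v"
    proof -
      have "g * f dvd p" using p(3) by (metis dvd_mult_right)
      moreover have "v = p - x_pow_minus_1 n * r" using vr(1) by simp
      ultimately show ?thesis using dvd by (metis dvd_diff dvd_mult2)
    qed
    from min_dist_le[OF dvd False vr(2) this] poly_weight_fold[OF vr(2) v] p(4)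
    show ?thesis by simp
  qed
qed

section \<open>Finite fields\<close>

lemma CARD_field_gt_1: "CARD('a::{field,finite}) > 1"
  using card_mono[of UNIV "{0, 1::'a}"] by simp

lemma of_nat_CARD_eq_0: "of_nat CARD('a::{field,finite}) = (0::'a)"
proof -
  have "bij (\<lambda>x::'a. x + 1)"
    by (rule bij_betw_byWitness[of _ "\<lambda>x. x - 1"]) auto
  hence "(\<Sum>x\<in>(UNIV::'a set). x + 1) = (\<Sum>x\<in>UNIV. x)"
    by (rule sum.reindex_bij_betw)
  thus ?thesis by (simp add: sum.distrib)
qed

lemma power_CARD_minus_1:
  fixes x :: "'a::{field,finite}"
  assumes "x \<noteq> 0"
  shows "x ^ (CARD('a) - 1) = 1"
proof -
  have "bij_betw (\<lambda>y. x * y) (UNIV - {0}) (UNIV - {0})"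
    using assms by (intro bij_betw_byWitness[of _ "\<lambda>y. y / x"]) auto
  hence "(\<Prod>y\<in>UNIV - {0}. x * y) = (\<Prod>y\<in>UNIV - {0}. y)"
    by (rule prod.reindex_bij_betw)
  hence "x ^ card (UNIV - {0::'a}) * (\<Prod>y\<in>UNIV - {0}. y) = (\<Prod>y\<in>UNIV - {0}. y)"
    by (simp add: prod.distrib)
  moreover have "(\<Prod>y\<in>UNIV - {0::'a}. y) \<noteq> 0" by simp
  ultimately show ?thesis by (simp add: card_Diff_singleton)
qed

lemma power_CARD:
  fixes x :: "'a::{field,finite}"
  shows "x ^ CARD('a) = x"
proof (cases "x = 0")
  case False
  have "x ^ CARD('a) = x * x ^ (CARD('a) - 1)"
    using power_Suc[of x "CARD('a) - 1"] by (simp del: power_Suc)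
  thus ?thesis by (metis power_CARD_minus_1[OF False] mult_1_right)
qed (simp add: zero_power)

lemma char_2_power_add:
  fixes x y :: "'a::comm_ring_1"
  assumes "(2::'a) = 0"
  shows "(x + y) ^ (2 ^ s) = x ^ (2 ^ s) + y ^ (2 ^ s)"
proof (induction s)
  case (Suc s)
  have "(x + y) ^ (2 ^ Suc s) = ((x + y) ^ (2 ^ s))\<^sup>2"
    by (simp only: power_Suc2 power_mult)
  also have "\<dots> = (x ^ (2 ^ s))\<^sup>2 + (y ^ (2 ^ s))\<^sup>2"
    unfolding Suc power2_sum using assms by simp
  finally show ?case by (simp only: power_Suc2 power_mult)
qed simp

text \<open>The image consists of \<open>q\<close> roots of \<open>x^q - x\<close>, which has no
  more than \<open>q\<close>. Membership in the base field thereby becomes invariance under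
  Frobenius.\<close>

lemma range_eq_power_fixpoints:
  fixes emb :: "'a::{field,finite} \<Rightarrow> 'b::field"
  assumes "field_hom emb"
  shows "range emb = {c. c ^ CARD('a) = c}"
proof (rule card_subset_eq)
  interpret field_hom emb by fact
  let ?q = "CARD('a)"
  have q: "?q > 1" by (rule CARD_field_gt_1)
  define p :: "'b poly" where "p = monom 1 ?q - monom 1 1"
  have "coeff p ?q = 1" using q by (simp add: p_def)
  hence p0: "p \<noteq> 0" by auto
  have roots: "{c. c ^ ?q = c} = {c. poly p c = 0}" by (auto simp: p_def poly_monom)
  show fin: "finite {c::'b. c ^ ?q = c}" unfolding roots by (rule poly_roots_finite[OF p0])
  show sub: "range emb \<subseteq> {c. c ^ ?q = c}" by (auto simp: power_CARD simp flip: hom_power)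
  have "card (range emb) = ?q" by (rule card_image) (rule inj_f)
  moreover have "card {c::'b. c ^ ?q = c} \<le> ?q"
  proof -
    have "degree p \<le> ?q" unfolding p_def
      by (intro degree_diff_le degree_monom_le order_trans[OF degree_monom_le]) (use q in auto)
    thus ?thesis unfolding roots using poly_roots_degree[OF p0] by simp
  qed
  ultimately show "card (range emb) = card {c::'b. c ^ ?q = c}"
    using card_mono[OF fin sub] by simp
qed

section \<open>Minimal polynomials and conjugates\<close>

text \<open>The witness \<open>r\<close> shows that \<open>x\<close> is algebraic; without it the
  \<open>THE\<close> in \<open>min_poly\<close> would have no solution.\<close>

lemma min_poly:
  fixes emb :: "'a::field \<Rightarrow> 'b::field"
  assumes hom: "field_hom emb" and r0: "r \<noteq> 0" "poly (map_poly emb r) x = 0"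
  shows "lead_coeff (min_poly emb x) = 1"
    and "poly (map_poly emb (min_poly emb x)) x = 0"
    and "poly (map_poly emb f) x = 0 \<Longrightarrow> min_poly emb x dvd f"
proof -
  interpret field_hom emb by fact
  interpret map_poly_hom: map_poly_inj_idom_hom emb ..
  define P where "P = (\<lambda>p. lead_coeff p = 1 \<and> poly (map_poly emb p) x = 0 \<and>
       (\<forall>r. r \<noteq> 0 \<and> poly (map_poly emb r) x = 0 \<longrightarrow> degree p \<le> degree r))"
  have dvd: "p dvd f" if p: "P p" and f: "poly (map_poly emb f) x = 0" for p f
  proof (rule ccontr)
    assume "\<not> p dvd f"
    hence m0: "f mod p \<noteq> 0" by (simp add: dvd_eq_mod_eq_0)
    have "f = p * (f div p) + f mod p" by simp
    hence "map_poly emb f = map_poly emb p * map_poly emb (f div p) + map_poly emb (f mod p)"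
      by (metis map_poly_hom.hom_add map_poly_hom.hom_mult)
    hence "poly (map_poly emb (f mod p)) x = 0" using p f by (simp add: P_def)
    hence "degree p \<le> degree (f mod p)" using p m0 by (simp add: P_def)
    moreover have "p \<noteq> 0" using p by (auto simp: P_def)
    ultimately show False using m0 degree_mod_less[of p f] by simp
  qed
  obtain p where p: "p \<noteq> 0" "poly (map_poly emb p) x = 0"
    and min: "\<And>f. f \<noteq> 0 \<Longrightarrow> poly (map_poly emb f) x = 0 \<Longrightarrow> degree p \<le> degree f"
    using ex_has_least_nat[of "\<lambda>p. p \<noteq> 0 \<and> poly (map_poly emb p) x = 0" r degree] r0 by auto
  have Pp: "P (Polynomial.smult (inverse (lead_coeff p)) p)"
    using p min by (simp add: P_def map_poly_hom_smult)
  have "min_poly emb x = (THE p. P p)" unfolding min_poly_def P_def ..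
  also have "P \<dots>"
  proof (rule theI[of P, OF Pp])
    fix f assume f: "P f"
    show "f = Polynomial.smult (inverse (lead_coeff p)) p"
      using f Pp by (intro monic_dvd_antisym dvd) (auto simp: P_def)
  qed
  finally have P: "P (min_poly emb x)" .
  show "lead_coeff (min_poly emb x) = 1" "poly (map_poly emb (min_poly emb x)) x = 0"
    using P by (auto simp: P_def)
  show "min_poly emb x dvd f" if "poly (map_poly emb f) x = 0" by (rule dvd[OF P that])
qed

text \<open>Frobenius permutes the factors of the orbit product, so its coefficients lie in the base
  field. The orbit may be run through several times, which does not matter when only its roots are
  to be located.\<close>

lemma conjugates_poly:
  fixes emb :: "'a::{field,finite} \<Rightarrow> 'b::{field,finite}"
  assumes hom: "field_hom emb" and q: "CARD('a) = q" "q = 2 ^ s"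
    and m: "CARD('b) = q ^ m" and two: "(2::'b) = 0"
  obtains r where "map_poly emb r = (\<Prod>k<m. [:- (\<gamma> ^ q ^ k), 1:])"
proof -
  interpret field_hom emb by fact
  let ?F = "\<Prod>k<m. [:- (\<gamma> ^ q ^ k), 1:]"
  define frob :: "'b \<Rightarrow> 'b" where "frob = (\<lambda>c. c ^ q)"
  have "q > 0" using q(2) by simp
  interpret frob: field_hom frob
    by unfold_locales
      (use \<open>q > 0\<close> in \<open>simp_all add: frob_def power_mult_distrib q(2) char_2_power_add[OF two]\<close>)
  interpret mfrob: map_poly_inj_idom_hom frob ..
  define fac where "fac = (\<lambda>k. [:- (\<gamma> ^ q ^ k), 1:])"
  have "frob (\<gamma> ^ q ^ k) = \<gamma> ^ q ^ Suc k" for k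
    by (simp add: frob_def mult.commute flip: power_mult)
  hence frob_fac: "map_poly frob (fac k) = fac (Suc k)" for k
    by (simp add: fac_def frob.map_poly_pCons_hom frob.hom_uminus)
  have "m > 0" using CARD_field_gt_1[where 'a = 'b] m by (cases m) auto
  then obtain l where l: "m = Suc l" by (cases m) auto
  have "map_poly frob ?F = prod (\<lambda>k. fac (Suc k)) {..<m}"
    unfolding mfrob.hom_prod frob_fac fac_def[symmetric] by (simp only: frob_fac fac_def[symmetric])
  \<comment> \<open>The shifted product closes up because \<gamma> raised to \<open>q ^ m\<close> is
    \<gamma> again.\<close>
  also have "\<dots> = prod fac {..<m}"
  proof -
    have "fac m = fac 0" using power_CARD[of \<gamma>] m by (simp add: fac_def)
    moreover have "prod (\<lambda>k. fac (Suc k)) {..<m} = prod (\<lambda>k. fac (Suc k)) {..<l} * fac m"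
      unfolding l by (rule prod.lessThan_Suc)
    moreover have "prod fac {..<m} = fac 0 * prod (\<lambda>k. fac (Suc k)) {..<l}"
      unfolding l by (rule prod.lessThan_Suc_shift)
    ultimately show ?thesis by (simp add: mult.commute)
  qed
  also have "\<dots> = ?F" by (simp add: fac_def)
  finally have "frob (coeff ?F i) = coeff ?F i" for i by (metis frob.coeff_map_poly_hom)
  hence rng: "coeff ?F i \<in> range emb" for i
    unfolding range_eq_power_fixpoints[OF hom] by (simp add: frob_def q(1))
  have inv0: "inv_into UNIV emb 0 = 0" by (metis hom_zero inj_f inv_f_f)
  have "map_poly emb (map_poly (inv_into UNIV emb) ?F) = ?F"
  proof (rule poly_eqI)
    fix i
    have "emb (inv_into UNIV emb (coeff ?F i)) = coeff ?F i" by (rule f_inv_into_f[OF rng])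
    thus "coeff (map_poly emb (map_poly (inv_into UNIV emb) ?F)) i = coeff ?F i"
      by (simp only: coeff_map_poly_hom coeff_map_poly[of "inv_into UNIV emb", OF inv0])
  qed
  thus thesis by (rule that)
qed

section \<open>Roots of the BCH polynomial\<close>

lemma primitive_root_power_eq_1:
  assumes "primitive_root_of_unity n \<beta>" "\<beta> ^ k = 1"
  shows "n dvd k"
proof -
  have "\<beta> ^ k = (\<beta> ^ n) ^ (k div n) * \<beta> ^ (k mod n)"
    by (simp flip: power_mult power_add)
  hence "\<beta> ^ (k mod n) = 1" using assms by (simp add: primitive_root_of_unity_def)
  moreover have "k mod n < n" using assms(1) by (simp add: primitive_root_of_unity_def)
  ultimately have "k mod n = 0" using assms(1) by (auto simp: primitive_root_of_unity_def)
  thus ?thesis by (simp add: dvd_eq_mod_eq_0)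
qed

lemma primitive_root_nonzero: "primitive_root_of_unity n \<beta> \<Longrightarrow> \<beta> \<noteq> 0"
  by (auto simp: primitive_root_of_unity_def zero_power)

lemma primitive_root_inj_on:
  assumes "primitive_root_of_unity n \<beta>"
  shows "inj_on (\<lambda>i. \<beta> ^ i) {..<n}"
proof (rule linorder_inj_onI)
  fix i j assume ij: "i < j" "i \<in> {..<n}" "j \<in> {..<n}"
  show "\<beta> ^ i \<noteq> \<beta> ^ j"
  proof
    assume "\<beta> ^ i = \<beta> ^ j"
    also have "\<beta> ^ j = \<beta> ^ i * \<beta> ^ (j - i)" using ij by (simp flip: power_add)
    finally have "\<beta> ^ (j - i) = 1" using primitive_root_nonzero[OF assms] by simp
    hence "n dvd j - i" by (rule primitive_root_power_eq_1[OF assms])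
    thus False using ij by (auto dest: dvd_imp_le)
  qed
qed auto

text \<open>If the support \<open>S\<close> had at most \<open>t\<close> elements, the polynomial vanishing at all \<open>\<beta>\<^sup>l\<close> with
  \<open>l \<in> S - {s}\<close> would have degree less than \<open>t\<close>, and combining the equations \<open>p(\<beta>\<^sup>j) = 0\<close> with
  its coefficients would isolate the coefficient of \<open>p\<close> at \<open>s\<close>.\<close>

lemma BCH_bound:
  fixes p :: "'b::field poly"
  assumes \<beta>: "primitive_root_of_unity n \<beta>" and p: "p \<noteq> 0" "degree p < n"
    and roots: "\<And>i. 1 \<le> i \<Longrightarrow> i \<le> t \<Longrightarrow> poly p (\<beta> ^ i) = 0"
  shows "t < poly_weight p"
proof (rule ccontr)
  assume "\<not> t < poly_weight p"
  define S where "S = {i. coeff p i \<noteq> 0}"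
  have card: "card S \<le> t" using \<open>\<not> t < poly_weight p\<close> by (simp add: S_def poly_weight_def)
  have fin: "finite S" by (simp add: S_def finite_support)
  have S: "S \<subseteq> {..<n}" unfolding S_def by (rule support_subset[OF p(2)])
  have s: "degree p \<in> S" using p(1) by (simp add: S_def)
  define s where "s = degree p"
  have poly_p: "poly p x = (\<Sum>l\<in>S. coeff p l * x ^ l)" for x
    unfolding poly_altdef by (rule sum.mono_neutral_right) (auto simp: S_def le_degree)
  define f where "f = (\<Prod>l\<in>S - {s}. [:- (\<beta> ^ l), 1:])"
  have "degree f = card (S - {s})"
    unfolding f_def by (subst degree_prod_sum_eq) auto
  hence degf: "degree f < card S"
    using card_Diff_singleton[of s S] card_gt_0_iff[of S] fin s by (auto simp: s_def)
  \<comment> \<open>The extra factor \<open>\<beta> ^ l\<close> turns the exponent \<open>j\<close>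
    into \<open>Suc j\<close>: the known zeros start at \<open>\<beta>\<close> itself, and
    \<open>Suc j\<close> stays within \<open>t\<close> since
    \<open>degree f < card S\<close>.\<close>
  have "(\<Sum>l\<in>S. coeff p l * \<beta> ^ l * poly f (\<beta> ^ l))
      = (\<Sum>l\<in>S. \<Sum>j\<le>degree f. coeff f j * (coeff p l * (\<beta> ^ Suc j) ^ l))"
    unfolding poly_altdef sum_distrib_left
    by (intro sum.cong refl) (simp add: power_mult_distrib mult_ac flip: power_mult)
  also have "\<dots> = (\<Sum>j\<le>degree f. coeff f j * poly p (\<beta> ^ Suc j))"
    unfolding poly_p sum_distrib_left by (rule sum.swap)
  also have "\<dots> = 0"
  proof (intro sum.neutral ballI)
    fix j assume "j \<in> {..degree f}"
    hence "poly p (\<beta> ^ Suc j) = 0" using degf card by (intro roots) auto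
    thus "coeff f j * poly p (\<beta> ^ Suc j) = 0" by simp
  qed
  finally have "(\<Sum>l\<in>S. coeff p l * \<beta> ^ l * poly f (\<beta> ^ l)) = 0" .
  moreover have "(\<Sum>l\<in>S. coeff p l * \<beta> ^ l * poly f (\<beta> ^ l)) = coeff p s * \<beta> ^ s * poly f (\<beta> ^ s)"
  proof (subst sum.remove[OF fin, of s])
    show "s \<in> S" using s by (simp add: s_def)
    have "poly f (\<beta> ^ l) = 0" if "l \<in> S - {s}" for l
      unfolding f_def poly_prod using that fin by (intro prod_zero) auto
    thus "coeff p s * \<beta> ^ s * poly f (\<beta> ^ s) + (\<Sum>l\<in>S - {s}. coeff p l * \<beta> ^ l * poly f (\<beta> ^ l))
        = coeff p s * \<beta> ^ s * poly f (\<beta> ^ s)" by simp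
  qed
  moreover have "poly f (\<beta> ^ s) \<noteq> 0"
  proof -
    have "\<beta> ^ s \<noteq> \<beta> ^ l" if "l \<in> S - {s}" for l
      using inj_onD[OF primitive_root_inj_on[OF \<beta>], of s l] that S s by (auto simp: s_def)
    thus ?thesis unfolding f_def poly_prod using fin by (auto simp: prod_zero_iff)
  qed
  moreover have "coeff p s \<noteq> 0" using p(1) by (simp add: s_def)
  ultimately show False using primitive_root_nonzero[OF \<beta>] by simp
qed

text \<open>The last claim holds because \<open>g\<close> divides the product of the orbit
  polynomials of the prescribed zeros. An inclusion of root sets is enough, so coincidences between
  minimal polynomials need no analysis.\<close>

lemma bch_poly:
  fixes emb :: "'a::{field_gcd,finite} \<Rightarrow> 'b::{field,finite}"
  assumes hom: "field_hom emb" and q: "CARD('a) = q" "q = 2 ^ s"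
    and m: "CARD('b) = q ^ m" and two: "(2::'b) = 0"
    and \<beta>: "primitive_root_of_unity n \<beta>" and \<delta>: "\<delta> \<ge> 2"
  defines "g \<equiv> bch_poly emb \<delta> 1 \<beta>"
  shows "lead_coeff g = 1"
    and "g dvd x_pow_minus_1 n"
    and "\<And>i. 1 \<le> i \<Longrightarrow> i \<le> \<delta> - 1 \<Longrightarrow> poly (map_poly emb g) (\<beta> ^ i) = 0"
    and "\<And>x. poly (map_poly emb g) x = 0 \<Longrightarrow> \<exists>i k. 1 \<le> i \<and> i \<le> \<delta> - 1 \<and> k < m \<and> x = \<beta> ^ (i * q ^ k)"
proof -
  interpret field_hom emb by fact
  interpret map_poly_hom: map_poly_inj_idom_hom emb ..
  let ?I = "{1..\<delta> - 1}"
  have "{1..1 + int \<delta> - 2} = int ` ?I"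
    using \<delta> by (simp add: image_int_atLeastAtMost of_nat_diff)
  hence g: "g = Lcm ((\<lambda>i. min_poly emb (\<beta> ^ i)) ` ?I)"
    by (simp add: g_def bch_poly_def image_image)
  have n: "n > 0" "\<beta> ^ n = 1" using \<beta> by (auto simp: primitive_root_of_unity_def)
  have xn0: "(x_pow_minus_1 n :: 'a poly) \<noteq> 0" by (rule x_pow_minus_1_nonzero[OF n(1)])
  have root: "poly (map_poly emb (x_pow_minus_1 n)) (\<beta> ^ i) = 0" for i
    using n(2) by (simp add: map_poly_hom.hom_minus poly_monom power_mult[symmetric] mult.commute[of i])
      (simp add: power_mult)
  note mp = min_poly[OF hom xn0 root]
  show gdvd: "g dvd x_pow_minus_1 n"
    unfolding g by (intro Lcm_least) (auto intro: mp(3) root)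
  have g0: "g \<noteq> 0" using gdvd xn0 by auto
  \<comment> \<open>\<open>Lcm\<close> is normalised, so the leading coefficient of \<open>g\<close>
    has unit factor 1; in a field a nonzero element equals its unit factor.\<close>
  have "unit_factor (normalize g) = 1" using g0 by simp
  hence "unit_factor g = 1" unfolding g normalize_Lcm .
  hence "unit_factor (lead_coeff g) = 1" by (simp add: unit_factor_poly_def one_pCons)
  moreover have "normalize (lead_coeff g) = 1"
    using g0 by (intro is_unit_normalize) (simp add: dvd_field_iff)
  ultimately show "lead_coeff g = 1" by (metis mult_1 unit_factor_mult_normalize)
  show "poly (map_poly emb g) (\<beta> ^ i) = 0" if "1 \<le> i" "i \<le> \<delta> - 1" for i
  proof -
    have "min_poly emb (\<beta> ^ i) dvd g" unfolding g using that by (intro dvd_Lcm) auto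
    then obtain e where "g = min_poly emb (\<beta> ^ i) * e" by (elim dvdE)
    thus ?thesis using mp(2)[of i] by (simp add: map_poly_hom.hom_mult)
  qed
  fix x assume x: "poly (map_poly emb g) x = 0"
  define r where "r = (\<lambda>\<gamma>. SOME r. map_poly emb r = (\<Prod>k<m. [:- (\<gamma> ^ q ^ k), 1:]))"
  have r: "map_poly emb (r \<gamma>) = (\<Prod>k<m. [:- (\<gamma> ^ q ^ k), 1:])" for \<gamma>
    unfolding r_def by (rule someI_ex) (use conjugates_poly[OF hom q m two, of \<gamma>] in blast)
  have "m > 0" using CARD_field_gt_1[where 'a = 'b] m by (cases m) auto
  hence "poly (map_poly emb (r \<gamma>)) \<gamma> = 0" for \<gamma>
    unfolding r poly_prod by (intro prod_zero bexI[of _ 0]) auto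
  hence "min_poly emb (\<beta> ^ i) dvd r (\<beta> ^ i)" for i by (rule mp(3))
  hence "g dvd (\<Prod>i\<in>?I. r (\<beta> ^ i))"
    unfolding g by (intro Lcm_least) (auto intro: dvd_trans dvd_prodI)
  then obtain e where "(\<Prod>i\<in>?I. r (\<beta> ^ i)) = g * e" by (elim dvdE)
  hence "poly (map_poly emb (\<Prod>i\<in>?I. r (\<beta> ^ i))) x = 0"
    using x by (simp add: map_poly_hom.hom_mult)
  hence "(\<Prod>i\<in>?I. \<Prod>k<m. x - (\<beta> ^ i) ^ q ^ k) = 0"
    by (simp add: map_poly_hom.hom_prod r poly_prod)
  then obtain i k where "i \<in> ?I" "k < m" "x = (\<beta> ^ i) ^ q ^ k"
    by (auto simp: prod_zero_iff)
  thus "\<exists>i k. 1 \<le> i \<and> i \<le> \<delta> - 1 \<and> k < m \<and> x = \<beta> ^ (i * q ^ k)"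
    by (auto simp: power_mult)
qed

section \<open>The BCH code contains its dual\<close>

lemma not_dvd_exponent_sum_aux:
  fixes q :: nat
  assumes Q: "Q = q ^ u" and ij: "1 \<le> i" "i \<le> Q - 2" "1 \<le> j" "j \<le> Q - 2" and au: "a \<le> u"
    and q: "q > 0"
  shows "\<not> Q * Q - 1 dvd i * q ^ a + j"
proof
  assume "Q * Q - 1 dvd i * q ^ a + j"
  hence "Q * Q - 1 \<le> i * q ^ a + j" using ij by (intro dvd_imp_le) auto
  also have "\<dots> \<le> (Q - 2) * Q + (Q - 2)"
    using ij au q unfolding Q by (intro add_mono mult_mono power_increasing) auto
  finally have *: "Q * Q - 1 \<le> (Q - 2) * Q + (Q - 2)" .
  have "Q = (Q - 2) + 2" using ij by linarith
  then obtain t where "Q = t + 2" by blast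
  thus False using * by (simp add: algebra_simps)
qed

text \<open>As \<open>q\<close> is invertible modulo \<open>Q * Q - 1\<close>, the smaller power of
  \<open>q\<close> can be cancelled, which leaves one exponent \<open>k - l\<close>.\<close>

lemma not_dvd_exponent_sum:
  fixes q :: nat
  assumes Q: "Q = q ^ u" and ij: "1 \<le> i" "i \<le> Q - 2" "1 \<le> j" "j \<le> Q - 2"
    and kl: "k < 2 * u" "l < 2 * u" and q: "q > 0"
  shows "\<not> Q * Q - 1 dvd i * q ^ k + j * q ^ l"
proof -
  let ?n = "Q * Q - 1"
  have Q2: "Q * Q = q ^ (2 * u)" unfolding Q by (simp flip: power_add add: mult_2)
  have Q1: "Q * Q = ?n + 1" using q unfolding Q by simp
  have "coprime ?n (?n + 1)" by simp
  hence "coprime ?n (q ^ (2 * u))" using Q1 Q2 by metis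
  hence "coprime ?n q" using kl(1) by simp
  hence cop: "coprime ?n (q ^ l)" for l by simp
  have main: "\<not> ?n dvd i * q ^ k + j * q ^ l"
    if ij: "1 \<le> i" "i \<le> Q - 2" "1 \<le> j" "j \<le> Q - 2" and k: "k < 2 * u" and lk: "l \<le> k" for i j k l
  proof
    assume "?n dvd i * q ^ k + j * q ^ l"
    also have "i * q ^ k + j * q ^ l = q ^ l * (i * q ^ (k - l) + j)"
      using lk by (simp add: algebra_simps flip: power_add)
    finally have dvd: "?n dvd i * q ^ (k - l) + j"
      using cop by (simp add: coprime_dvd_mult_right_iff)
    show False
    proof (cases "k - l \<le> u")
      case True
      thus False using not_dvd_exponent_sum_aux[OF Q ij True q] dvd by simp
    next
      case False
      \<comment> \<open>An exponent above \<open>u\<close> is traded for its complement: multiplying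
        by \<open>q ^ ?b\<close> turns \<open>q ^ (k - l)\<close> into \<open>q ^ (2 * u)\<close>,
        which is 1 modulo \<open>?n\<close>, and \<open>j\<close> takes over the role of
        \<open>i\<close>.\<close>
      let ?b = "2 * u - (k - l)"
      have "?n dvd (i * q ^ (k - l) + j) * q ^ ?b" using dvd by (rule dvd_mult2)
      also have "(i * q ^ (k - l) + j) * q ^ ?b = i * (q ^ (k - l) * q ^ ?b) + j * q ^ ?b"
        by (simp add: algebra_simps)
      also have "q ^ (k - l) * q ^ ?b = q ^ (2 * u)" using k lk by (simp flip: power_add)
      also have "q ^ (2 * u) = ?n + 1" by (rule trans[OF Q2[symmetric] Q1])
      also have "i * (?n + 1) + j * q ^ ?b = ?n * i + (j * q ^ ?b + i)" by (simp add: algebra_simps)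
      finally have "?n dvd j * q ^ ?b + i" by (simp only: dvd_add_right_iff dvd_triv_left)
      moreover have "?b \<le> u" using False by simp
      ultimately show False using not_dvd_exponent_sum_aux[OF Q ij(3,4,1,2) _ q] by blast
    qed
  qed
  show ?thesis
  proof (cases "l \<le> k")
    case True thus ?thesis by (rule main[OF ij kl(1)])
  next
    case False
    hence "k \<le> l" by simp
    from main[OF ij(3,4,1,2) kl(2) this] show ?thesis by (simp add: add.commute)
  qed
qed

lemma map_poly_reflect_poly:
  assumes "field_hom emb"
  shows "map_poly emb (reflect_poly p) = reflect_poly (map_poly emb p)"
proof -
  interpret field_hom emb by fact
  show ?thesis by (intro poly_eqI) (simp add: coeff_reflect_poly)
qed

text \<open>Every nonzero element of \<open>'b\<close> is a root of \<open>x^n - 1\<close>. A common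
  divisor \<open>c\<close> has none of them as a root, so its cofactor has all \<open>n\<close> of
  them, which leaves degree 0 for \<open>c\<close>.\<close>

lemma coprime_reflect_poly:
  fixes emb :: "'a::field_gcd \<Rightarrow> 'b::{field,finite}" and g :: "'a poly"
  assumes hom: "field_hom emb" and n: "n = CARD('b) - 1" "n > 0"
    and gdvd: "g dvd x_pow_minus_1 n"
    and disj: "\<And>x. poly (map_poly emb g) x = 0 \<Longrightarrow> x \<noteq> 0 \<Longrightarrow> poly (map_poly emb g) (inverse x) \<noteq> 0"
  shows "coprime g (reflect_poly g)"
proof (rule coprimeI)
  interpret field_hom emb by fact
  interpret map_poly_hom: map_poly_inj_idom_hom emb ..
  fix c assume cg: "c dvd g" and cr: "c dvd reflect_poly g"
  obtain e where e: "x_pow_minus_1 n = c * e" using dvd_trans[OF cg gdvd] by (elim dvdE)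
  have xn0: "(x_pow_minus_1 n :: 'a poly) \<noteq> 0" by (rule x_pow_minus_1_nonzero[OF n(2)])
  have ce0: "c \<noteq> 0" "e \<noteq> 0" using xn0 unfolding e by auto
  have "poly (map_poly emb e) x = 0" if x: "x \<noteq> 0" for x
  proof -
    have "poly (map_poly emb (x_pow_minus_1 n)) x = 0"
      using power_CARD_minus_1[OF x] n(1) by (simp add: map_poly_hom.hom_minus poly_monom)
    hence "poly (map_poly emb c) x = 0 \<or> poly (map_poly emb e) x = 0"
      unfolding e by (simp add: map_poly_hom.hom_mult)
    moreover have "poly (map_poly emb c) x \<noteq> 0"
    proof
      assume c: "poly (map_poly emb c) x = 0"
      have root: "poly (map_poly emb f) x = 0" if "c dvd f" for f
        using that c by (elim dvdE) (simp add: map_poly_hom.hom_mult)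
      have "poly (reflect_poly (map_poly emb g)) x = 0"
        using root[OF cr] by (simp add: map_poly_reflect_poly[OF hom])
      hence "poly (map_poly emb g) (inverse x) = 0" using x by (simp add: poly_reflect_poly_nz)
      thus False using disj[OF root[OF cg] x] by simp
    qed
    ultimately show ?thesis by simp
  qed
  hence "UNIV - {0} \<subseteq> {x. poly (map_poly emb e) x = 0}" by auto
  moreover have e0: "map_poly emb e \<noteq> 0" using ce0 by simp
  ultimately have "card (UNIV - {0::'b}) \<le> card {x. poly (map_poly emb e) x = 0}"
    by (intro card_mono poly_roots_finite)
  also have "\<dots> \<le> degree e" using poly_roots_degree[OF e0] by simp
  finally have "n \<le> degree e" unfolding n(1) by (simp add: card_Diff_singleton)
  moreover have "degree c + degree e = n"
    using degree_x_pow_minus_1[OF n(2), where 'a = 'a] degree_mult_eq[OF ce0] unfolding e by simp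
  ultimately show "is_unit c" using ce0 by (simp add: is_unit_iff_degree)
qed

section \<open>Generators of the dual and of the double dual\<close>

lemma generator_dvd_dual_generator:
  fixes g h :: "'a::field_gcd poly"
  assumes gh: "g * h = x_pow_minus_1 n" and n: "n > 0" and cop: "coprime g (reflect_poly g)"
  shows "g dvd monic_reciprocal h"
proof -
  have xn0: "(x_pow_minus_1 n :: 'a poly) \<noteq> 0" by (rule x_pow_minus_1_nonzero[OF n])
  have "poly g 0 * poly h 0 = - 1"
    using arg_cong[OF gh, of "\<lambda>p. poly p 0"] poly_0_x_pow_minus_1[OF n, where 'a = 'a] by simp
  hence h0: "poly h 0 \<noteq> 0" by auto
  have "reflect_poly (x_pow_minus_1 n :: 'a poly) = - x_pow_minus_1 n"
    by (rule reflect_poly_x_pow_minus_1[OF n])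
  hence "reflect_poly g * reflect_poly h = - (g * h)"
    by (simp flip: reflect_poly_mult add: gh)
  hence "g dvd reflect_poly g * reflect_poly h" by simp
  hence "g dvd reflect_poly h" using cop by (simp add: coprime_dvd_mult_right_iff)
  thus ?thesis unfolding monic_reciprocal_def by (rule dvd_smult)
qed

lemma monic_reciprocal_mult:
  "monic_reciprocal (p * q :: 'a::field poly) = monic_reciprocal p * monic_reciprocal q"
  by (simp add: monic_reciprocal_def reflect_poly_mult mult.commute)

text \<open>The easy inclusion of a code in its double dual gives one divisibility; equality of
  degrees and monicity do the rest.\<close>

lemma monic_reciprocal_of_dual:
  fixes g h k :: "'a::field poly"
  assumes gh: "g * h = x_pow_minus_1 n" and k: "monic_reciprocal h * k = x_pow_minus_1 n"
    and n: "n > 0" and lc: "lead_coeff g = 1"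
  shows "monic_reciprocal k = g"
proof -
  note Dh = dual_code_generated_by[OF gh n] and Dk = dual_code_generated_by[OF k n]
  have gdvd: "g dvd x_pow_minus_1 n" using gh[symmetric] by simp
  have "code_generated_by n g \<subseteq> dual_code n (dual_code n (code_generated_by n g))"
    by (auto simp: dual_code_def code_generated_by_def intro: comm_scalar_prod[THEN trans])
  hence "code_generated_by n g \<subseteq> code_generated_by n (monic_reciprocal k)"
    unfolding Dh(1) Dk(1) .
  hence dvd: "monic_reciprocal k dvd g"
    using code_generated_by_subset_iff[OF Dk(2) gdvd n] by simp
  have xn0: "(x_pow_minus_1 n :: 'a poly) \<noteq> 0" by (rule x_pow_minus_1_nonzero[OF n])
  have nz: "g \<noteq> 0" "h \<noteq> 0" "monic_reciprocal h \<noteq> 0" "k \<noteq> 0"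
    using xn0 gh[symmetric] k[symmetric] by auto
  have "degree g + degree h = n" "degree h + degree k = n"
    using degree_mult_eq[OF nz(1,2)] degree_mult_eq[OF nz(3,4)] Dh(4)
      degree_x_pow_minus_1[OF n, where 'a = 'a] by (simp_all add: gh k)
  hence deg: "degree (monic_reciprocal k) = degree g" using Dk(4) by simp
  obtain a where a: "g = monic_reciprocal k * a" using dvd by (elim dvdE)
  hence "degree a = 0" "a \<noteq> 0"
    using nz(1) deg degree_mult_eq[of "monic_reciprocal k" a] by auto
  hence "is_unit a" by (simp add: is_unit_iff_degree)
  hence "g dvd monic_reciprocal k" unfolding a by (simp add: mult_unit_dvd_iff)
  thus ?thesis using dvd lc Dk(3) by (intro monic_dvd_antisym)
qed

theorem theorem1:
  fixes emb :: "'a::{field_gcd,finite} \<Rightarrow> 'b::{field,finite}"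
    and \<beta> :: 'b
    and q m n \<delta> d :: nat
    and g h g_perp :: "'a poly"
    and C C' :: "'a vec set"
  assumes "\<exists>s\<ge>1. q = 2 ^ s"
    and "even m"
    and "CARD('a) = q"
    and "CARD('b) = q ^ m"
    and "field_hom emb"
    and "n = q ^ m - 1"
    and "primitive_root_of_unity n \<beta>"
    and "\<delta> = q ^ (m div 2) - 1"
    and "\<delta> \<ge> 2"
    and "C = bch_code emb n \<delta> 1 \<beta>"
    and "g = generator_poly n C"
    and "h = x_pow_minus_1 n div g"
    and "g_perp = monic_reciprocal h"
    and "C' = code_generated_by (2 * n) (g * g_perp)"
    and "d = min (2 * min_dist C) (min_dist (dual_code n C))"
  shows "is_generator_poly n (dual_code n C) g_perp
    \<and> is_generator_poly (2 * n) C' (g * g_perp)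
    \<and> cyclic_code (2 * n) C'
    \<and> self_dual (2 * n) C'
    \<and> has_parameters C' (2 * n) n d
    \<and> d \<ge> q ^ (m div 2) - 1"
proof -
  interpret field_hom emb by fact
  obtain s where s: "s \<ge> 1" "q = 2 ^ s" using assms(1) by blast
  obtain u where u: "m = 2 * u" using assms(2) by (elim evenE)
  define Q where "Q = q ^ u"
  have Qm: "q ^ m = Q * Q" by (simp add: Q_def u mult_2 power_add)
  have nQ: "n = Q * Q - 1" by (simp add: assms(6) Qm)
  have \<delta>: "\<delta> = Q - 1" using assms(8) u by (simp add: Q_def)
  have Q3: "Q \<ge> 3" using assms(9) \<delta> by simp
  have u0: "u > 0" using Q3 by (cases u) (auto simp: Q_def)
  have q0: "q > 0" using s by simp
  \<comment> \<open>Oddness of \<open>n\<close> is needed twice: it makes \<open>n\<close> nonzero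
    in characteristic 2, and it drives the lift to even exponents.\<close>
  have "even (q ^ m)" using u0 s by (simp add: u)
  hence n: "n > 0" "odd n"
    using assms(7) q0 unfolding assms(6) by (auto simp: primitive_root_of_unity_def)
  have "(2::'a) ^ s = 0" using of_nat_CARD_eq_0[where 'a = 'a] assms(3) s(2) by simp
  hence two: "(2::'a) = 0" by simp
  have "(2::'b) ^ (s * m) = 0"
    using of_nat_CARD_eq_0[where 'a = 'b] assms(4) s(2) by (simp add: power_mult)
  hence two_b: "(2::'b) = 0" by simp
  note bch = bch_poly[OF assms(5) assms(3) s(2) assms(4) two_b assms(7) assms(9)]
  have "g = bch_poly emb \<delta> 1 \<beta>"
    unfolding assms(11) assms(10) bch_code_def
    by (rule generator_poly_code_generated_by[OF bch(1,2) n(1)])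
  hence C: "C = code_generated_by n g" and lc: "lead_coeff g = 1" and gdvd: "g dvd x_pow_minus_1 n"
    and roots: "\<And>i. 1 \<le> i \<Longrightarrow> i \<le> \<delta> - 1 \<Longrightarrow> poly (map_poly emb g) (\<beta> ^ i) = 0"
    and conj: "\<And>x. poly (map_poly emb g) x = 0 \<Longrightarrow>
      \<exists>i k. 1 \<le> i \<and> i \<le> \<delta> - 1 \<and> k < m \<and> x = \<beta> ^ (i * q ^ k)"
    using bch assms(10) by (simp_all add: bch_code_def)
  have gh: "g * h = x_pow_minus_1 n" using gdvd assms(12) by simp
  note D = dual_code_generated_by[OF gh n(1), folded assms(13)]
  have dual: "dual_code n C = code_generated_by n g_perp" unfolding C by (rule D(1))
  obtain k where k: "g_perp * k = x_pow_minus_1 n" using D(2) by (metis dvdE)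
  have xn0: "(x_pow_minus_1 n :: 'a poly) \<noteq> 0" by (rule x_pow_minus_1_nonzero[OF n(1)])
  have nz: "g \<noteq> 0" "h \<noteq> 0" "g_perp \<noteq> 0" using xn0 gh[symmetric] k[symmetric] by auto
  have deg: "degree g + degree h = n"
    using degree_mult_eq[OF nz(1,2)] degree_x_pow_minus_1[OF n(1), where 'a = 'a] by (simp add: gh)

  have "coprime g (reflect_poly g)"
  proof (rule coprime_reflect_poly[OF assms(5) _ n(1) gdvd])
    show "n = CARD('b) - 1" using assms(4,6) by simp
    fix x assume x: "poly (map_poly emb g) x = 0" "x \<noteq> 0"
    show "poly (map_poly emb g) (inverse x) \<noteq> 0"
    proof
      assume "poly (map_poly emb g) (inverse x) = 0"
      then obtain j l where jl: "1 \<le> j" "j \<le> \<delta> - 1" "l < m" "inverse x = \<beta> ^ (j * q ^ l)"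
        using conj by blast
      obtain i k where ik: "1 \<le> i" "i \<le> \<delta> - 1" "k < m" "x = \<beta> ^ (i * q ^ k)"
        using conj[OF x(1)] by blast
      have "\<beta> ^ (i * q ^ k + j * q ^ l) = x * inverse x"
        unfolding jl(4) unfolding ik(4) by (rule power_add)
      hence "n dvd i * q ^ k + j * q ^ l"
        using x(2) by (intro primitive_root_power_eq_1[OF assms(7)]) simp
      moreover have "i \<le> Q - 2" "j \<le> Q - 2" using ik(2) jl(2) unfolding \<delta> by simp_all
      ultimately show False
        using not_dvd_exponent_sum[OF Q_def _ _ _ _ _ _ q0, of i j k l] ik jl
        unfolding nQ u by blast
    qed
  qed
  hence "g dvd g_perp"
    unfolding assms(13) by (rule generator_dvd_dual_generator[OF gh n(1)])
  then obtain f where f: "g_perp = g * f" by (elim dvdE)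

  \<comment> \<open>A constant \<open>g\<close> would give \<open>g_perp\<close> degree
    \<open>n\<close> and a zero dual code, whose minimum distance is unspecified; the zero
    \<open>\<beta>\<close> of \<open>g\<close> excludes this.\<close>
  have degg: "degree g > 0"
  proof (rule ccontr)
    assume "\<not> degree g > 0"
    hence "g = 1" using lc by (metis degree_0_id gr0I one_pCons)
    moreover have "1 \<le> \<delta> - 1" using assms(9) by simp
    note roots[OF order_refl this]
    ultimately show False by simp
  qed
  have deg_perp: "degree g_perp < n" "degree g < n"
  proof -
    show "degree g_perp < n" using D(4) deg degg by simp
    thus "degree g < n" using dvd_imp_degree_le[OF \<open>g dvd g_perp\<close> nz(3)] by simp
  qed

  have x2n: "x_pow_minus_1 (2 * n) = x_pow_minus_1 n * (x_pow_minus_1 n :: 'a poly)"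
  proof -
    have "(2 :: 'a poly) = 0" using two by (simp flip: numeral_poly add: numeral_poly)
    moreover have "monom 1 (2 * n) = monom 1 n * monom (1::'a) n" by (simp add: mult_monom mult_2)
    ultimately show ?thesis by (simp add: algebra_simps)
  qed
  have n2: "2 * n > 0" using n by simp
  \<comment> \<open>The check polynomial of \<open>g * g_perp\<close> is the product of the two
    check polynomials, so its reciprocal is \<open>g_perp * g\<close> and self-duality follows from
    the description of duals.\<close>
  have GH: "(g * g_perp) * (h * k) = x_pow_minus_1 (2 * n)"
    unfolding x2n gh[symmetric] using k gh by (simp add: mult_ac)
  have Gdvd: "g * g_perp dvd x_pow_minus_1 (2 * n)" using GH by (metis dvd_triv_left)
  have gen: "is_generator_poly n (dual_code n C) g_perp"
    using D dual by (simp add: is_generator_poly_def)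
  have gen': "is_generator_poly (2 * n) C' (g * g_perp)"
    using Gdvd lc D(3) assms(14) by (simp add: is_generator_poly_def lead_coeff_mult)
  have cyc: "cyclic_code (2 * n) C'"
    unfolding assms(14) by (rule cyclic_code_generated_by[OF Gdvd n2])
  have self: "self_dual (2 * n) C'"
  proof -
    have "monic_reciprocal (h * k) = g_perp * g"
      unfolding monic_reciprocal_mult using monic_reciprocal_of_dual[OF gh _ n(1) lc, of k] k assms(13)
      by simp
    thus ?thesis unfolding self_dual_def assms(14) dual_code_generated_by(1)[OF GH n2]
      by (simp add: mult.commute)
  qed
  have "min_dist C' = d"
    using min_dist_repeated_root[of n g f, OF two n(2)] D(2) deg_perp(1) Gdvd
    unfolding assms(14,15) dual unfolding C f by simp
  moreover have "code_dim (2 * n) C' = n"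
    using degree_mult_eq[OF nz(1,3)] deg D(4)
    unfolding assms(14) code_dim_generated_by[OF Gdvd n2] by simp
  ultimately have par: "has_parameters C' (2 * n) n d"
    using cyc by (simp add: has_parameters_def cyclic_code_def)

  \<comment> \<open>Stated for all multiples of \<open>g\<close>, so that it also covers the dual
    code through \<open>g dvd g_perp\<close>.\<close>
  have bound: "\<delta> \<le> poly_weight p" if p: "p \<noteq> 0" "degree p < n" "g dvd p" for p
  proof -
    interpret map_poly_hom: map_poly_inj_idom_hom emb ..
    have "\<delta> - 1 < poly_weight (map_poly emb p)"
    proof (rule BCH_bound[OF assms(7)])
      fix i assume "1 \<le> i" "i \<le> \<delta> - 1"
      thus "poly (map_poly emb p) (\<beta> ^ i) = 0"
        using p(3) roots by (elim dvdE) (simp add: map_poly_hom.hom_mult)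
    qed (use p in auto)
    thus ?thesis by (simp add: poly_weight_def)
  qed
  have "\<delta> \<le> min_dist C"
    unfolding C using min_dist_attained[OF gdvd deg_perp(2)] bound by metis
  moreover have "\<delta> \<le> min_dist (dual_code n C)"
    unfolding dual using min_dist_attained[OF D(2) deg_perp(1)] bound \<open>g dvd g_perp\<close>
    by (metis dvd_trans)
  ultimately have "\<delta> \<le> d" unfolding assms(15) by simp
  thus ?thesis using gen gen' cyc self par assms(8) by simp
qed

end
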